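(* Let $L$ be a linear subspace of $\mathbb{S}^n$ that contains the identity matrix $I$ but is not closed under matrix squaring. Let $K:=\mathbb{S}^n_+\cap L$, with the barrier $F(X)=-\ln\det X$ on $\operatorname{int}(K)$, and dual cone $K^*=\{S\in L:\operatorname{Tr}(SX)\ge0\ \forall X\in K\}$. Then there exist $X\in\operatorname{int}(K)$ and $S\in\operatorname{int}(K^* )$ such that, for all $W\in\operatorname{int}(K)$, either $F''(W)[X]\ne S$ or $F''(W)[-F_*'(S)]\ne-F'(X)$.
   Context: $\mathbb{S}^n$ is the space of real symmetric $n\times n$ matrices and $\mathbb{S}^n_+$ the cone of positive semidefinite ones. The ambient space is $\mathbb{E}=L$, identified with its dual via the trace inner product $\operatorname{Tr}(AB)$; interiors are taken relative to $L$. $F'(X)\in L$ and $F''(X):L\to L$ denote the gradient and Hessian of $F$ on $L$ with respect to this inner product. The conjugate barrier is $F_*(S):=\sup\{-\operatorname{Tr}(SX)-F(X):X\in\operatorname{int}(K)\}$ for $S\in\operatorname{int}(K^* )$, and $F_*'(S)\in L$ is its gradient. *)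

theory Defs
  imports "HOL-Analysis.Analysis"
begin

definition sym_matrices :: "(real^'n^'n) set" where
  "sym_matrices = {A. transpose A = A}"

definition psd_matrices :: "(real^'n^'n) set" where
  "psd_matrices = {A \<in> sym_matrices. \<forall>v. 0 \<le> v \<bullet> (A *v v)}"

definition psd_section :: "(real^'n^'n) set \<Rightarrow> (real^'n^'n) set" where
  "psd_section L = psd_matrices \<inter> L"

definition dual_cone_in :: "(real^'n^'n) set \<Rightarrow> (real^'n^'n) set \<Rightarrow> (real^'n^'n) set" where
  "dual_cone_in L K = {S \<in> L. \<forall>X\<in>K. 0 \<le> trace (S ** X)}"

abbreviation interior_in :: "(real^'n^'n) set \<Rightarrow> (real^'n^'n) set \<Rightarrow> (real^'n^'n) set" where
  "interior_in L A \<equiv> (top_of_set L) interior_of A"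

text \<open>Derivatives are taken within the subspace \<open>L\<close>. At a point of \<open>L\<close> the values of such a
  derivative are unique only in directions of \<open>L\<close> (first lemma); the gradient is therefore required
  to lie in \<open>L\<close>, and the Hessian \<open>hess_in L f x h\<close> is meaningful for \<open>h \<in> L\<close>.
  Both operators read \<open>f\<close> only on a neighbourhood of \<open>x\<close> in \<open>L\<close>, so \<open>f\<close> may take arbitrary values
  outside an open subset of \<open>L\<close>.\<close>

lemma has_derivative_within_subspace_unique:
  fixes L :: "'a::real_normed_vector set" and f :: "'a \<Rightarrow> 'b::real_normed_vector"
  assumes "subspace L" "x \<in> L" "h \<in> L"
    and D: "(f has_derivative D) (at x within L)"
    and E: "(f has_derivative E) (at x within L)"
  shows "D h = E h"
proof -
  let ?l = "\<lambda>t::real. x + t *\<^sub>R h"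
  have sub: "range ?l \<subseteq> L"
    using assms by (auto intro: subspace_add subspace_scale)
  have *: "((\<lambda>t. f (?l t)) has_derivative (\<lambda>t. G (t *\<^sub>R h))) (at 0)"
    if G: "(f has_derivative G) (at x within L)" for G
  proof -
    have "(?l has_derivative (\<lambda>t. t *\<^sub>R h)) (at 0)"
      by (auto intro!: derivative_eq_intros)
    moreover have "(f has_derivative G) (at (?l 0) within range ?l)"
      using has_derivative_subset[OF G sub] by simp
    ultimately show ?thesis
      using has_derivative_in_compose by blast
  qed
  have "(\<lambda>t. D (t *\<^sub>R h)) = (\<lambda>t. E (t *\<^sub>R h))"
    using has_derivative_unique[OF *[OF D] *[OF E]] .
  then show ?thesis
    by (metis scaleR_one)
qed

definition grad_in :: "(real^'n^'n) set \<Rightarrow> (real^'n^'n \<Rightarrow> real) \<Rightarrow> real^'n^'n \<Rightarrow> real^'n^'n" where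
  "grad_in L f x =
     (THE g. g \<in> L \<and> (f has_derivative (\<lambda>h. trace (g ** h))) (at x within L))"

definition hess_in ::
    "(real^'n^'n) set \<Rightarrow> (real^'n^'n \<Rightarrow> real) \<Rightarrow> real^'n^'n \<Rightarrow> real^'n^'n \<Rightarrow> real^'n^'n" where
  "hess_in L f x h =
     (THE v. \<exists>D. (grad_in L f has_derivative D) (at x within L) \<and> D h = v)"

lemma trace_mult_eq_inner:
  fixes A B :: "real^'n^'n"
  assumes "A \<in> sym_matrices"
  shows "trace (A ** B) = A \<bullet> B"
proof -
  have "A $ i $ j = A $ j $ i" for i j
    using assms by (auto simp: sym_matrices_def transpose_def vec_eq_iff)
  then have "trace (A ** B) = (\<Sum>i\<in>UNIV. \<Sum>j\<in>UNIV. A $ j $ i * B $ j $ i)"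
    by (simp add: trace_def matrix_matrix_mult_def)
  also have "\<dots> = A \<bullet> B"
    by (subst sum.swap) (simp add: inner_vec_def)
  finally show ?thesis .
qed

lemma grad_in_eqI:
  assumes L: "subspace L" "L \<subseteq> sym_matrices" "x \<in> L" and g: "g \<in> L"
    and D: "(f has_derivative (\<lambda>h. trace (g ** h))) (at x within L)"
  shows "grad_in L f x = g"
  unfolding grad_in_def
proof (rule the_equality)
  fix g' assume g': "g' \<in> L \<and> (f has_derivative (\<lambda>h. trace (g' ** h))) (at x within L)"
  then have d: "g' - g \<in> L"
    using L g by (auto intro: subspace_diff)
  have "trace (g' ** (g' - g)) = trace (g ** (g' - g))"
    using has_derivative_within_subspace_unique[OF L(1,3) d] g' D by blast
  then have "(g' - g) \<bullet> (g' - g) = 0"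
    using g g' L(2) by (simp add: trace_mult_eq_inner subset_iff inner_diff_left)
  then show "g' = g" by simp
qed (use g D in auto)

lemma hess_in_eqI:
  assumes "subspace L" "x \<in> L" "h \<in> L"
    and "(grad_in L f has_derivative D) (at x within L)"
  shows "hess_in L f x h = D h"
  unfolding hess_in_def
  using assms has_derivative_within_subspace_unique by blast

definition log_det_barrier :: "real^'n^'n \<Rightarrow> real" where
  "log_det_barrier X = - ln (det X)"

text \<open>The supremum is a real one, hence meaningful only where the set is bounded above; this is
  the case for \<open>S\<close> in the interior of the dual cone, the intended domain.\<close>

definition conjugate_barrier :: "(real^'n^'n) set \<Rightarrow> real^'n^'n \<Rightarrow> real" where
  "conjugate_barrier L S =
     (SUP X \<in> interior_in L (psd_section L). - trace (S ** X) - log_det_barrier X)"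

end

theory Submission
  imports Defs
begin

text \<open>Write \<open>P\<close> for the orthogonal projection onto \<open>L\<close>. Then \<open>F'(X) = - P(X\<^sup>-\<^sup>1)\<close>,
  \<open>F''(W)[H] = P(W\<^sup>-\<^sup>1 H W\<^sup>-\<^sup>1)\<close>, and \<open>F\<^sub>*'(P(Y\<^sup>-\<^sup>1)) = - Y\<close>. Take \<open>X = I\<close> and \<open>S = P(Y\<^sup>-\<^sup>1)\<close> with
  \<open>Y = I + t B\<close>, where \<open>B \<in> L\<close> but \<open>B\<^sup>2 \<notin> L\<close>, and let \<open>t\<close> tend to \<open>0\<close> from above. If \<open>W\<close> is a scaling
  point and \<open>U = W\<^sup>-\<^sup>1\<close>, the matrices \<open>U\<^sup>2 - Y\<^sup>-\<^sup>1\<close> and \<open>E = U Y U - I\<close> are orthogonal to \<open>L\<close>. Testing them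
  against \<open>I\<close>, \<open>W\<close> and \<open>Y\<close> shows that \<open>W\<close> tends to \<open>I\<close> and gives an exact identity that forces
  \<open>E = O(N\<^sup>3)\<close>, where \<open>N = W - I\<close>. Expanding \<open>Y = W (I + E) W\<close> then yields \<open>N = t B / 2 + o(t)\<close> and
  \<open>N\<^sup>2 + W E W = t B - 2 N \<in> L\<close>. Division by \<open>t\<^sup>2\<close> gives \<open>B\<^sup>2 / 4 \<in> L\<close>, since \<open>L\<close> is closed.\<close>

section \<open>Positive definite matrices\<close>

definition pd_matrices :: "(real^'n^'n) set" where
  "pd_matrices = {A \<in> sym_matrices. \<forall>v. v \<noteq> 0 \<longrightarrow> 0 < v \<bullet> (A *v v)}"

section \<open>Matrix product and trace as bounded maps for the Frobenius norm\<close>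

text \<open>The norm of \<open>real^'n^'n\<close> is the Frobenius norm, and an entry of the product
  pairs a row of \<open>A\<close> with a row of \<open>transpose B\<close>. Cauchy-Schwarz for each
  entry leaves a double sum that factors.\<close>

lemma norm_matrix_mult_le:
  fixes A B :: "real^'n^'n"
  shows "norm (A ** B) \<le> norm A * norm B"
proof (rule power2_le_imp_le)
  have sq: "(norm M)\<^sup>2 = (\<Sum>i\<in>UNIV. (norm (M $ i))\<^sup>2)" for M :: "real^'n^'n"
    by (simp add: norm_vec_def L2_set_def sum_nonneg)
  have nt: "norm (transpose B) = norm B"
    unfolding norm_eq_sqrt_inner inner_vec_def transpose_def
    by (simp, subst sum.swap, simp)
  have "(norm (A ** B))\<^sup>2 = (\<Sum>i\<in>UNIV. \<Sum>j\<in>UNIV. (A $ i \<bullet> transpose B $ j)\<^sup>2)"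
    unfolding power2_norm_eq_inner inner_vec_def
    by (simp add: matrix_matrix_mult_def transpose_def power2_eq_square)
  also have "\<dots> \<le> (\<Sum>i\<in>UNIV. \<Sum>j\<in>UNIV. (norm (A $ i))\<^sup>2 * (norm (transpose B $ j))\<^sup>2)"
    by (intro sum_mono) (metis Cauchy_Schwarz_ineq power2_norm_eq_inner)
  also have "\<dots> = (norm A * norm B)\<^sup>2"
    by (metis nt power_mult_distrib sq sum_product)
  finally show "(norm (A ** B))\<^sup>2 \<le> (norm A * norm B)\<^sup>2" .
qed simp

lemma norm_matrix_mult3_le:
  fixes A B C :: "real^'n^'n"
  shows "norm (A ** B ** C) \<le> norm A * norm B * norm C"
  by (rule order_trans[OF norm_matrix_mult_le mult_right_mono[OF norm_matrix_mult_le]]) simp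

interpretation mm: bounded_bilinear "(**) :: real^'n^'n \<Rightarrow> real^'n^'n \<Rightarrow> real^'n^'n"
proof
  fix a b c :: "real^'n^'n" and r :: real
  show "(a + b) ** c = a ** c + b ** c"
    by (simp add: matrix_matrix_mult_def vec_eq_iff algebra_simps sum.distrib)
  show "a ** (b + c) = a ** b + a ** c"
    by (rule matrix_add_ldistrib)
  show *: "(r *\<^sub>R a) ** b = r *\<^sub>R (a ** b)"
    by (rule scalar_matrix_assoc[symmetric])
  show "a ** (r *\<^sub>R b) = r *\<^sub>R (a ** b)"
    unfolding *[symmetric] by (rule matrix_scalar_ac)
  show "\<exists>K. \<forall>(a :: real^'n^'n) (b :: real^'n^'n). norm (a ** b) \<le> norm a * norm b * K"
    by (intro exI[of _ 1] allI) (simp add: norm_matrix_mult_le)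
qed

lemma trace_eq_inner_mat_1: "trace (A :: real^'n^'n) = mat 1 \<bullet> A"
  using trace_mult_eq_inner[of "mat 1" A] by (simp add: sym_matrices_def)

lemma bounded_linear_trace: "bounded_linear (trace :: real^'n^'n \<Rightarrow> real)"
  unfolding trace_eq_inner_mat_1[abs_def] by (rule bounded_linear_inner_right)

lemma trace_scaleR: "trace (c *\<^sub>R A) = c * trace (A :: real^'n^'n)"
  and trace_minus: "trace (- A) = - trace (A :: real^'n^'n)"
  and trace_zero: "trace (0 :: real^'n^'n) = 0"
  by (simp_all add: trace_eq_inner_mat_1)

lemmas mat_algebra = mm.add_left mm.add_right mm.diff_left mm.diff_right mm.minus_left mm.minus_right
  mm.scaleR_left mm.scaleR_right mm.zero_left mm.zero_right trace_add trace_sub trace_minus trace_scaleR trace_zero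

section \<open>Symmetric and semidefinite matrices, congruence, Cauchy-Schwarz\<close>

lemma transpose_add: "transpose (A + B) = transpose A + transpose (B :: real^'n^'n)"
  by (simp add: transpose_def vec_eq_iff)

lemma sym_matrices_iff: "A \<in> sym_matrices \<longleftrightarrow> transpose A = A"
  by (simp add: sym_matrices_def)

lemma subspace_sym_matrices: "subspace (sym_matrices :: (real^'n^'n) set)"
  by (auto simp: subspace_def sym_matrices_def transpose_add transpose_scalar)
     (simp add: transpose_def vec_eq_iff)

lemma sym_matrices_inner: "A \<in> sym_matrices \<Longrightarrow> x \<bullet> (A *v y) = (A *v x) \<bullet> (y :: real^'n)"
  by (metis (no_types) dot_lmul_matrix sym_matrices_iff transpose_matrix_vector)

lemma sym_matrices_congruence:
  "A \<in> sym_matrices \<Longrightarrow> D \<in> sym_matrices \<Longrightarrow> D ** A ** D \<in> (sym_matrices :: (real^'n^'n) set)"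
  by (simp add: sym_matrices_iff matrix_transpose_mul matrix_mul_assoc)

lemma pd_imp_psd: "A \<in> pd_matrices \<Longrightarrow> A \<in> psd_matrices"
  by (auto simp: pd_matrices_def psd_matrices_def) (metis inner_zero_left less_eq_real_def)

lemma pd_imp_sym: "A \<in> pd_matrices \<Longrightarrow> A \<in> sym_matrices"
  and psd_imp_sym: "A \<in> psd_matrices \<Longrightarrow> A \<in> sym_matrices"
  by (auto simp: pd_matrices_def psd_matrices_def)

lemma mat_1_pd: "mat 1 \<in> pd_matrices"
  by (simp add: pd_matrices_def sym_matrices_iff)

lemma psd_congruence:
  assumes "A \<in> psd_matrices" "D \<in> sym_matrices"
  shows "D ** A ** D \<in> psd_matrices"
proof -
  have "v \<bullet> ((D ** A ** D) *v v) = (D *v v) \<bullet> (A *v (D *v v))" for v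
    using sym_matrices_inner[OF assms(2)] by (simp add: matrix_vector_mul_assoc[symmetric])
  then show ?thesis
    using assms by (auto simp: psd_matrices_def sym_matrices_congruence)
qed

text \<open>The form at \<open>t x + y\<close> is a nonnegative quadratic polynomial in
  \<open>t\<close>, so its discriminant is at most 0.\<close>

lemma psd_Cauchy_Schwarz:
  assumes M: "M \<in> psd_matrices"
  shows "(x \<bullet> (M *v y))\<^sup>2 \<le> (x \<bullet> (M *v x)) * (y \<bullet> (M *v y))"
proof -
  let ?q = "\<lambda>a b. a \<bullet> (M *v b)"
  have s: "?q y x = ?q x y"
    using sym_matrices_inner[OF psd_imp_sym[OF M], of y x] by (simp add: inner_commute)
  have *: "0 \<le> ?q x x * t\<^sup>2 + 2 * ?q x y * t + ?q y y" for t
  proof -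
    have "0 \<le> ?q (t *\<^sub>R x + y) (t *\<^sub>R x + y)"
      using M by (simp add: psd_matrices_def)
    also have "\<dots> = ?q x x * t\<^sup>2 + 2 * ?q x y * t + ?q y y"
      by (simp add: matrix_vector_right_distrib matrix_vector_mult_scaleR inner_left_distrib
          inner_right_distrib s power2_eq_square algebra_simps)
    finally show ?thesis .
  qed
  have nn: "0 \<le> ?q x x" using M by (simp add: psd_matrices_def)
  show ?thesis
  proof (cases "?q x x = 0")
    case True
    have "?q x y = 0"
    proof (rule ccontr)
      assume "?q x y \<noteq> 0"
      \<comment> \<open>With leading coefficient 0 the polynomial is affine; at this
        \<open>t\<close> it would take the value -1.\<close>
      then have "2 * ?q x y * ((- ?q y y - 1) / (2 * ?q x y)) = - ?q y y - 1"
        by simp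
      with *[of "(- ?q y y - 1) / (2 * ?q x y)"] show False
        using True by simp
    qed
    then show ?thesis using True by simp
  next
    case False
    then have p: "0 < ?q x x" using nn by simp
    \<comment> \<open>The argument is the minimiser \<open>t = - q x y / q x x\<close>.\<close>
    have "0 \<le> ?q x x * (?q x x * (- ?q x y / ?q x x)\<^sup>2 + 2 * ?q x y * (- ?q x y / ?q x x) + ?q y y)"
      by (rule mult_nonneg_nonneg[OF nn *])
    also have "\<dots> = ?q x x * ?q y y - (?q x y)\<^sup>2"
      using p by (simp add: field_simps power2_eq_square)
    finally show ?thesis by simp
  qed
qed

section \<open>Rank-one deflation and positivity of traces of products\<close>

definition outer :: "real^'n \<Rightarrow> real^'n^'n" where
  "outer u = (\<chi> i j. u $ i * u $ j)"

lemma outer_mult_vec: "outer u *v x = (u \<bullet> x) *\<^sub>R u"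
  by (simp add: outer_def matrix_vector_mult_def vec_eq_iff inner_vec_def sum_distrib_left
      sum_distrib_right mult_ac)

lemma trace_mult_outer: "trace (A ** outer u) = u \<bullet> (A *v u)"
  by (simp add: outer_def matrix_matrix_mult_def trace_def matrix_vector_mult_def inner_vec_def
      sum_distrib_left mult_ac)

lemma psd_diag_nonneg: "M \<in> psd_matrices \<Longrightarrow> 0 \<le> M $ i $ i"
  by (auto simp: psd_matrices_def dest!: spec[of _ "axis i 1"]
      simp: matrix_vector_mul_component inner_axis' matrix_vector_mult_basis column_def)

text \<open>One step of the Cholesky decomposition.\<close>

lemma psd_deflate:
  assumes M: "M \<in> psd_matrices" and i: "0 < M $ i $ i"
  defines "u \<equiv> M *v axis i 1"
  defines "M' \<equiv> M - (1 / M $ i $ i) *\<^sub>R outer u"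
  shows "M' \<in> psd_matrices" "row i M' = 0" "row j M = 0 \<Longrightarrow> row j M' = 0"
proof -
  have u: "u $ k = M $ k $ i" for k
    by (simp add: u_def matrix_vector_mult_basis column_def)
  have s: "M $ k $ l = M $ l $ k" for k l
    using psd_imp_sym[OF M] by (simp add: sym_matrices_iff transpose_def vec_eq_iff)
  have "v \<bullet> (M' *v v) = v \<bullet> (M *v v) - (v \<bullet> u)\<^sup>2 / M $ i $ i" for v
    by (simp add: M'_def matrix_vector_mult_diff_rdistrib inner_diff_right outer_mult_vec
        scaleR_matrix_vector_assoc[symmetric] power2_eq_square inner_commute)
  \<comment> \<open>The subtracted rank-one term is controlled by Cauchy-Schwarz for
    \<open>v\<close> and the \<open>i\<close>-th basis vector, whose form value is
    \<open>M $ i $ i\<close>.\<close>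
  moreover have "(v \<bullet> u)\<^sup>2 / M $ i $ i \<le> v \<bullet> (M *v v)" for v
  proof -
    have "axis i 1 \<bullet> (M *v axis i 1) = M $ i $ i"
      by (simp add: inner_axis' matrix_vector_mult_basis column_def)
    then show ?thesis
      using psd_Cauchy_Schwarz[OF M, of v "axis i 1"] i by (simp add: u_def field_simps)
  qed
  moreover have "M' \<in> sym_matrices"
    by (simp add: M'_def sym_matrices_iff transpose_def vec_eq_iff outer_def s mult.commute)
  ultimately show "M' \<in> psd_matrices"
    by (auto simp: psd_matrices_def)
  show "row i M' = 0"
    using i by (simp add: row_def M'_def vec_eq_iff outer_def u s)
  show "row j M' = 0" if "row j M = 0"
    using that by (simp add: row_def M'_def vec_eq_iff outer_def u)
qed

text \<open>Cauchy-Schwarz on basis vectors bounds the square of entry \<open>(i, j)\<close> by the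
  product of the diagonal entries \<open>i\<close> and \<open>j\<close>.\<close>

lemma psd_diag_0: "M \<in> psd_matrices \<Longrightarrow> M $ i $ i = 0 \<Longrightarrow> row i M = 0"
proof -
  assume M: "M \<in> psd_matrices" and i: "M $ i $ i = 0"
  have "M $ i $ j = 0" for j
    using psd_Cauchy_Schwarz[OF M, of "axis i 1" "axis j 1"] i
    by (simp add: inner_axis' matrix_vector_mult_basis column_def)
  then show ?thesis by (simp add: row_def vec_eq_iff)
qed

text \<open>Repeated deflation splits \<open>M\<close> into terms
  \<open>outer u / M $ i $ i\<close>, each of which contributes a nonnegative multiple of
  \<open>u \<bullet> (A *v u)\<close>. No square root or spectral decomposition enters.\<close>

lemma trace_psd_mult_nonneg:
  assumes A: "A \<in> psd_matrices" and M: "M \<in> psd_matrices"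
  shows "0 \<le> trace (A ** M)"
proof -
  \<comment> \<open>\<open>I\<close> contains the indices of all nonzero rows; deflating at
    \<open>i\<close> clears row \<open>i\<close> and leaves zero rows zero.\<close>
  have "finite I \<Longrightarrow> M \<in> psd_matrices \<Longrightarrow> (\<forall>j. j \<notin> I \<longrightarrow> row j M = 0) \<Longrightarrow> 0 \<le> trace (A ** M)" for I
  proof (induction I arbitrary: M rule: finite_induct)
    case empty
    then have "M = 0" by (simp add: vec_eq_iff row_def)
    then show ?case by (simp add: mat_algebra)
  next
    case (insert i I)
    show ?case
    proof (cases "M $ i $ i = 0")
      case True
      then have "row i M = 0" using psd_diag_0 insert.prems by blast
      then show ?thesis using insert by (metis insert_iff)
    next
      case False
      then have p: "0 < M $ i $ i" using psd_diag_nonneg[OF insert.prems(1), of i] by simp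
      let ?u = "M *v axis i 1"
      let ?M = "M - (1 / M $ i $ i) *\<^sub>R outer ?u"
      note d = psd_deflate[OF insert.prems(1) p]
      have "0 \<le> trace (A ** ?M)"
        using insert.IH[OF d(1)] d(2,3) insert.prems(2) by (metis insert_iff)
      moreover have "trace (A ** M) = trace (A ** ?M) + (1 / M $ i $ i) * (?u \<bullet> (A *v ?u))"
        by (simp add: mat_algebra trace_mult_outer)
      moreover have "0 \<le> ?u \<bullet> (A *v ?u)" using A by (simp add: psd_matrices_def)
      ultimately show ?thesis using p by simp
    qed
  qed
  from this[of UNIV] show ?thesis using M by simp
qed

text \<open>A single deflation at a positive diagonal entry suffices: its rank-one term is strictly
  positive and the remainder contributes at least 0.\<close>

lemma trace_pd_mult_pos:
  assumes A: "A \<in> pd_matrices" and M: "M \<in> psd_matrices" "M \<noteq> 0"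
  shows "0 < trace (A ** M)"
proof -
  obtain i where "M $ i $ i \<noteq> 0"
    using psd_diag_0[OF M(1)] M(2) by (auto simp: vec_eq_iff row_def)
  then have p: "0 < M $ i $ i" using psd_diag_nonneg[OF M(1), of i] by simp
  let ?u = "M *v axis i 1"
  let ?M = "M - (1 / M $ i $ i) *\<^sub>R outer ?u"
  have "?u $ i \<noteq> 0" using p by (simp add: matrix_vector_mult_basis column_def)
  then have "?u \<noteq> 0" by auto
  then have "0 < ?u \<bullet> (A *v ?u)" using A by (auto simp: pd_matrices_def)
  moreover have "trace (A ** M) = trace (A ** ?M) + (1 / M $ i $ i) * (?u \<bullet> (A *v ?u))"
    by (simp add: mat_algebra trace_mult_outer)
  moreover have "0 \<le> trace (A ** ?M)"
    using trace_psd_mult_nonneg[OF pd_imp_psd[OF A] psd_deflate(1)[OF M(1) p]] .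
  ultimately show ?thesis using p by (simp add: add_nonneg_pos)
qed

text \<open>\<open>D ** B ** D\<close> is semidefinite, and nonzero because its form is positive at
  any \<open>w\<close> with \<open>D *v w\<close> nonzero. This is the source of the strict
  concavity of \<open>ln (det X)\<close>.\<close>

lemma trace_congruence_pos:
  assumes A: "A \<in> pd_matrices" and B: "B \<in> pd_matrices" and D: "D \<in> sym_matrices" "D \<noteq> 0"
  shows "0 < trace (A ** D ** B ** D)"
proof -
  obtain w where "D *v w \<noteq> 0"
    using D(2) by (metis matrix_eq matrix_vector_mult_0)
  then have "0 < (D *v w) \<bullet> (B *v (D *v w))" using B by (auto simp: pd_matrices_def)
  also have "\<dots> = w \<bullet> ((D ** B ** D) *v w)"
    using sym_matrices_inner[OF D(1)] by (simp add: matrix_vector_mul_assoc[symmetric])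
  finally have "D ** B ** D \<noteq> 0" by auto
  then show ?thesis
    using trace_pd_mult_pos[OF A psd_congruence[OF pd_imp_psd[OF B] D(1)]]
    by (simp add: matrix_mul_assoc)
qed

section \<open>Inverses, determinants and interior of the positive definite cone\<close>

lemma matrix_inv_cancel:
  assumes "invertible (A :: real^'n^'n)"
  shows "A ** matrix_inv A = mat 1" "matrix_inv A ** A = mat 1"
proof -
  have "A ** matrix_inv A = mat 1 \<and> matrix_inv A ** A = mat 1"
    using assms unfolding invertible_def matrix_inv_def by (rule someI_ex)
  then show "A ** matrix_inv A = mat 1" "matrix_inv A ** A = mat 1" by auto
qed

lemma pd_invertible:
  assumes "A \<in> pd_matrices"
  shows "invertible A"
proof -
  have "x = 0" if "A *v x = 0" for x
    using assms that by (auto simp: pd_matrices_def)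
  then show ?thesis
    by (simp add: invertible_left_inverse matrix_left_invertible_ker)
qed

lemmas pd_inv_cancel = matrix_inv_cancel[OF pd_invertible]

lemma matrix_inv_mat_1: "matrix_inv (mat 1) = (mat 1 :: real^'n^'n)"
  using pd_inv_cancel(1)[OF mat_1_pd] by simp

text \<open>Substituting \<open>v = A *v w\<close> with \<open>w = matrix_inv A *v v\<close> turns
  the form of the inverse at \<open>v\<close> into the form of \<open>A\<close> at \<open>w\<close>.
  Symmetry holds since the transposed inverse is a left inverse as well.\<close>

lemma matrix_inv_pd:
  assumes A: "A \<in> pd_matrices"
  shows "matrix_inv A \<in> pd_matrices"
proof -
  let ?V = "matrix_inv A"
  have "transpose ?V ** A = mat 1"
    using arg_cong[OF pd_inv_cancel(1)[OF A], of transpose] pd_imp_sym[OF A]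
    by (simp add: matrix_transpose_mul sym_matrices_iff)
  then have "transpose ?V ** A ** ?V = ?V"
    by simp
  then have s: "transpose ?V = ?V"
    by (simp add: pd_inv_cancel(1)[OF A] flip: matrix_mul_assoc)
  have "0 < v \<bullet> (?V *v v)" if "v \<noteq> 0" for v
  proof -
    have v: "A *v (?V *v v) = v"
      using pd_inv_cancel(1)[OF A] by (simp add: matrix_vector_mul_assoc)
    then have "?V *v v \<noteq> 0" using that by auto
    then have "0 < (?V *v v) \<bullet> (A *v (?V *v v))" using A by (auto simp: pd_matrices_def)
    then show ?thesis by (simp add: v inner_commute)
  qed
  with s show ?thesis by (simp add: pd_matrices_def sym_matrices_iff)
qed

lemma convex_pd: "convex (pd_matrices :: (real^'n^'n) set)"
proof (rule convexI)
  fix A B :: "real^'n^'n" and s t :: real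
  assume A: "A \<in> pd_matrices" and B: "B \<in> pd_matrices" and st: "0 \<le> s" "0 \<le> t" "s + t = 1"
  have "s *\<^sub>R A + t *\<^sub>R B \<in> sym_matrices"
    by (intro subspace_add subspace_scale subspace_sym_matrices pd_imp_sym A B)
  moreover have "0 < v \<bullet> ((s *\<^sub>R A + t *\<^sub>R B) *v v)" if v: "v \<noteq> 0" for v
  proof -
    have "0 < v \<bullet> (A *v v)" "0 < v \<bullet> (B *v v)"
      using A B v by (auto simp: pd_matrices_def)
    then have "0 < s * (v \<bullet> (A *v v)) + t * (v \<bullet> (B *v v))"
      using st by (cases "s = 0") (simp_all add: add_pos_nonneg)
    then show ?thesis
      by (simp add: matrix_vector_mult_add_rdistrib inner_add_right flip: scaleR_matrix_vector_assoc)
  qed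
  ultimately show "s *\<^sub>R A + t *\<^sub>R B \<in> pd_matrices"
    by (auto simp: pd_matrices_def)
qed

lemma continuous_det: "continuous_on S (det :: real^'n^'n \<Rightarrow> real)"
  unfolding det_def by (intro continuous_intros)

text \<open>The cone is convex, hence connected, and contains \<open>mat 1\<close> with determinant
  1. A value at most 0 would by continuity produce a singular positive definite matrix.\<close>

lemma det_pd_pos:
  assumes A: "(A :: real^'n^'n) \<in> pd_matrices"
  shows "0 < det A"
proof (rule ccontr)
  let ?D = "det ` (pd_matrices :: (real^'n^'n) set)"
  assume "\<not> 0 < det A"
  then have 0: "0 \<in> {det A..1}" by simp
  have "connected ?D"
    by (intro connected_continuous_image continuous_det convex_connected convex_pd)
  moreover have "1 \<in> ?D"
    by (rule image_eqI[OF _ mat_1_pd]) simp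
  ultimately have "{det A..1} \<subseteq> ?D"
    using A by (intro connected_contains_Icc) auto
  then obtain M :: "real^'n^'n" where "M \<in> pd_matrices" "det M = 0"
    using 0 by (metis imageE subsetD)
  then show False
    using pd_invertible invertible_det_nz by blast
qed

lemma norm_outer: "norm (outer v) = v \<bullet> v"
proof -
  have "outer v \<in> sym_matrices"
    by (simp add: sym_matrices_iff outer_def transpose_def mult.commute)
  then have "outer v \<bullet> outer v = (v \<bullet> v)\<^sup>2"
    using trace_mult_eq_inner[of "outer v" "outer v"]
    by (simp add: trace_mult_outer outer_mult_vec power2_eq_square)
  then show ?thesis
    unfolding norm_eq_sqrt_inner[of "outer v"] by simp
qed

text \<open>The form is the inner product of \<open>M\<close> with \<open>outer v\<close>, a matrix
  of norm \<open>v \<bullet> v\<close>.\<close>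

lemma sym_quadratic_form_le:
  assumes "M \<in> sym_matrices"
  shows "\<bar>v \<bullet> (M *v v)\<bar> \<le> norm M * (v \<bullet> v)"
  using Cauchy_Schwarz_ineq2[of M "outer v"] trace_mult_eq_inner[OF assms, of "outer v"]
  by (simp add: trace_mult_outer norm_outer)

text \<open>The constant is the minimum of the form on the compact unit sphere; homogeneity extends
  the bound to all \<open>v\<close>.\<close>

lemma pd_coercive:
  assumes A: "(A :: real^'n^'n) \<in> pd_matrices"
  obtains a where "0 < a" "\<And>v. a * (v \<bullet> v) \<le> v \<bullet> (A *v v)"
proof -
  \<comment> \<open>Any index serves: only nonemptiness of the sphere is at stake.\<close>
  have "axis undefined 1 \<in> (sphere 0 1 :: (real^'n) set)"
    unfolding mem_sphere_0 by (rule norm_axis_1)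
  then have "sphere 0 1 \<noteq> ({} :: (real^'n) set)"
    by blast
  moreover have "continuous_on (sphere 0 1) (\<lambda>v. v \<bullet> (A *v v))"
    by (intro continuous_on_inner continuous_on_id linear_continuous_on matrix_vector_mul_bounded_linear)
  ultimately obtain u where u: "u \<in> sphere 0 1" "\<And>v. v \<in> sphere 0 1 \<Longrightarrow> u \<bullet> (A *v u) \<le> v \<bullet> (A *v v)"
    using continuous_attains_inf[OF compact_sphere, of 0 1 "\<lambda>v. v \<bullet> (A *v v)"] by blast
  show thesis
  proof
    have "u \<noteq> 0" using u(1) by auto
    then show "0 < u \<bullet> (A *v u)" using A by (simp add: pd_matrices_def)
    fix v :: "real^'n"
    show "u \<bullet> (A *v u) * (v \<bullet> v) \<le> v \<bullet> (A *v v)"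
    proof (cases "v = 0")
      case False
      let ?c = "inverse (norm v)"
      have c: "?c * ?c * (v \<bullet> v) = 1"
        using False by (simp add: dot_square_norm power2_eq_square field_simps)
      have "u \<bullet> (A *v u) \<le> (?c *\<^sub>R v) \<bullet> (A *v (?c *\<^sub>R v))"
        using False by (intro u(2)) simp
      also have "\<dots> = ?c * ?c * (v \<bullet> (A *v v))"
        by (simp add: matrix_vector_mult_scaleR)
      finally have "u \<bullet> (A *v u) * (v \<bullet> v) \<le> ?c * ?c * (v \<bullet> (A *v v)) * (v \<bullet> v)"
        by (rule mult_right_mono) simp
      also have "\<dots> = ?c * ?c * (v \<bullet> v) * (v \<bullet> (A *v v))"
        by (simp only: mult_ac)
      finally show ?thesis by (simp only: c mult_1)
    qed simp
  qed
qed

text \<open>The coercivity constant of \<open>A\<close> is a valid radius, since a symmetric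
  perturbation of smaller norm changes the form by less than
  \<open>a * (v \<bullet> v)\<close>.\<close>

lemma pd_open_in_sym:
  assumes A: "(A :: real^'n^'n) \<in> pd_matrices"
  obtains e where "0 < e" "\<And>B. B \<in> sym_matrices \<Longrightarrow> norm (B - A) < e \<Longrightarrow> B \<in> pd_matrices"
proof -
  obtain a where a: "0 < a" "\<And>v. a * (v \<bullet> v) \<le> v \<bullet> (A *v v)"
    using pd_coercive[OF A] by blast
  show thesis
  proof
    fix B :: "real^'n^'n" assume B: "B \<in> sym_matrices" "norm (B - A) < a"
    have "0 < v \<bullet> (B *v v)" if "v \<noteq> 0" for v
    proof -
      have "\<bar>v \<bullet> ((B - A) *v v)\<bar> \<le> norm (B - A) * (v \<bullet> v)"
        by (intro sym_quadratic_form_le subspace_diff subspace_sym_matrices B pd_imp_sym A)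
      also have "\<dots> < a * (v \<bullet> v)" using B(2) that by simp
      finally show ?thesis
        using a(2)[of v] by (simp add: matrix_vector_mult_diff_rdistrib inner_diff_right)
    qed
    with B(1) show "B \<in> pd_matrices" by (simp add: pd_matrices_def)
  qed (use a in auto)
qed

lemma interior_in_iff:
  assumes "A \<subseteq> L"
  shows "x \<in> interior_in L A \<longleftrightarrow> x \<in> L \<and> (\<exists>e>0. \<forall>y\<in>L. norm (y - x) < e \<longrightarrow> y \<in> A)"
proof
  assume "x \<in> interior_in L A"
  then obtain T where T: "openin (top_of_set L) T" "x \<in> T" "T \<subseteq> A"
    by (auto simp: interior_of_def)
  then obtain e where "0 < e" "ball x e \<inter> L \<subseteq> T"
    by (meson openin_contains_ball)
  moreover have "x \<in> L" using T assms by auto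
  ultimately show "x \<in> L \<and> (\<exists>e>0. \<forall>y\<in>L. norm (y - x) < e \<longrightarrow> y \<in> A)"
    using T(3) by (auto simp: subset_iff dist_norm norm_minus_commute)
next
  assume "x \<in> L \<and> (\<exists>e>0. \<forall>y\<in>L. norm (y - x) < e \<longrightarrow> y \<in> A)"
  then obtain e where e: "x \<in> L" "0 < e" "\<forall>y\<in>L. norm (y - x) < e \<longrightarrow> y \<in> A" by auto
  have "openin (top_of_set L) (L \<inter> ball x e)" by auto
  moreover have "L \<inter> ball x e \<subseteq> A"
    using e by (auto simp: dist_norm norm_minus_commute)
  ultimately show "x \<in> interior_in L A"
    using e by (auto simp: interior_of_def)
qed

text \<open>From an interior point one may move by \<open>- d *\<^sub>R mat 1\<close> inside
  \<open>L\<close> and stay semidefinite, which leaves a margin \<open>d * (v \<bullet> v)\<close>.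
  The converse is openness of the positive definite cone.\<close>

lemma interior_psd_section:
  fixes L :: "(real^'n^'n) set"
  assumes L: "subspace L" "L \<subseteq> sym_matrices" "mat 1 \<in> L"
  shows "interior_in L (psd_section L) = pd_matrices \<inter> L"
proof (intro equalityI subsetI)
  fix X assume "X \<in> interior_in L (psd_section L)"
  then obtain e where e: "X \<in> L" "0 < e" "\<And>Y. Y \<in> L \<Longrightarrow> norm (Y - X) < e \<Longrightarrow> Y \<in> psd_section L"
    by (subst (asm) interior_in_iff) (auto simp: psd_section_def)
  define d where "d = e / (2 * norm (mat 1 :: real^'n^'n))"
  have n1: "norm (mat 1 :: real^'n^'n) > 0"
    by (auto simp: mat_def vec_eq_iff)
  have d: "0 < d" "norm (d *\<^sub>R (mat 1 :: real^'n^'n)) < e"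
    using e(2) n1 by (auto simp: d_def)
  have "X - d *\<^sub>R mat 1 \<in> psd_section L"
    using d(2) by (intro e(3) subspace_diff subspace_scale L e(1)) auto
  then have "0 \<le> v \<bullet> ((X - d *\<^sub>R mat 1) *v v)" for v
    by (auto simp: psd_section_def psd_matrices_def)
  then have "d * (v \<bullet> v) \<le> v \<bullet> (X *v v)" for v
    by (simp add: matrix_vector_mult_diff_rdistrib inner_diff_right flip: scaleR_matrix_vector_assoc)
  moreover have "0 < d * (v \<bullet> v)" if "v \<noteq> 0" for v :: "real^'n" using d that by simp
  ultimately show "X \<in> pd_matrices \<inter> L"
    using e(1) L(2) by (auto simp: pd_matrices_def intro: less_le_trans)
next
  fix X assume X: "X \<in> pd_matrices \<inter> L"
  then obtain e where e: "0 < e" "\<And>B. B \<in> sym_matrices \<Longrightarrow> norm (B - X) < e \<Longrightarrow> B \<in> pd_matrices"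
    using pd_open_in_sym by (metis (no_types, lifting) IntD1)
  then show "X \<in> interior_in L (psd_section L)"
    using X L(2) pd_imp_psd by (subst interior_in_iff) (auto simp: psd_section_def intro!: exI[of _ e])
qed

section \<open>Derivatives of the determinant, its logarithm and the inverse\<close>

text \<open>In the differentiated Leibniz formula only the identity permutation survives at
  \<open>mat 1\<close>.\<close>

lemma has_derivative_det_mat_1:
  "((det :: real^'n^'n \<Rightarrow> real) has_derivative trace) (at (mat 1))"
proof -
  let ?P = "{p :: 'n \<Rightarrow> 'n. p permutes UNIV}"
  have *: "(\<Sum>i\<in>UNIV. H $ i $ p i * (\<Prod>j\<in>UNIV - {i}. (mat 1 :: real^'n^'n) $ j $ p j))
      = (if p = id then trace H else 0)" if p: "p \<in> ?P" for p and H :: "real^'n^'n"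
  proof (cases "p = id")
    case True
    then show ?thesis by (simp add: mat_def trace_def)
  next
    case False
    \<comment> \<open>A nonzero product would make \<open>p\<close> fix every index except perhaps
      \<open>i\<close>; an injective \<open>p\<close> then fixes \<open>i\<close> too.\<close>
    have 0: "(\<Prod>j\<in>UNIV - {i}. (mat 1 :: real^'n^'n) $ j $ p j) = 0" for i
    proof (rule ccontr)
      assume "(\<Prod>j\<in>UNIV - {i}. (mat 1 :: real^'n^'n) $ j $ p j) \<noteq> 0"
      then have fx: "p j = j" if "j \<noteq> i" for j
        using that by (auto simp: mat_def split: if_splits)
      have "inj p" using p by (simp add: permutes_inj)
      then have "p i = i" using fx by (metis injD)
      then have "p = id" using fx by fastforce
      with False show False by simp
    qed
    show ?thesis unfolding 0 using False by simp
  qed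
  have c: "((\<lambda>A::real^'n^'n. A $ i $ j) has_derivative (\<lambda>H. H $ i $ j)) F" for i j F
    by (intro bounded_linear_imp_has_derivative) (simp add: bounded_linear_intros
        bounded_linear_compose[OF bounded_linear_vec_nth bounded_linear_vec_nth])
  have "((det :: real^'n^'n \<Rightarrow> real) has_derivative (\<lambda>H. \<Sum>p\<in>?P. of_int (sign p) *
      (\<Sum>i\<in>UNIV. H $ i $ p i * (\<Prod>j\<in>UNIV - {i}. (mat 1 :: real^'n^'n) $ j $ p j)))) (at (mat 1))"
    unfolding det_def[abs_def]
    by (intro has_derivative_sum has_derivative_mult_right has_derivative_prod c)
  also have "(\<lambda>H::real^'n^'n. \<Sum>p\<in>?P. of_int (sign p) *
      (\<Sum>i\<in>UNIV. H $ i $ p i * (\<Prod>j\<in>UNIV - {i}. (mat 1 :: real^'n^'n) $ j $ p j))) = trace"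
  proof
    fix H :: "real^'n^'n"
    have "(\<Sum>p\<in>?P. of_int (sign p) *
      (\<Sum>i\<in>UNIV. H $ i $ p i * (\<Prod>j\<in>UNIV - {i}. (mat 1 :: real^'n^'n) $ j $ p j)))
      = (\<Sum>p\<in>?P. if p = id then trace H else 0)"
      by (intro sum.cong refl) (simp only: *, simp add: sign_id)
    also have "\<dots> = trace H"
      by (simp add: sum.delta finite_permutations permutes_id)
    finally show "(\<Sum>p\<in>?P. of_int (sign p) *
      (\<Sum>i\<in>UNIV. H $ i $ p i * (\<Prod>j\<in>UNIV - {i}. (mat 1 :: real^'n^'n) $ j $ p j))) = trace H" .
  qed
  finally show ?thesis .
qed

text \<open>Jacobi's formula is transported from \<open>mat 1\<close> to \<open>A\<close> by
  \<open>det Z = det A * det (matrix_inv A ** Z)\<close>.\<close>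

lemma has_derivative_det:
  assumes "invertible (A :: real^'n^'n)"
  shows "(det has_derivative (\<lambda>H. det A * trace (matrix_inv A ** H))) (at A)"
proof -
  have 1: "((\<lambda>Z. matrix_inv A ** Z) has_derivative (\<lambda>H. matrix_inv A ** H)) (at A)"
    by (intro bounded_linear_imp_has_derivative mm.bounded_linear_right)
  have "(det \<circ> (\<lambda>Z. matrix_inv A ** Z) has_derivative trace \<circ> (\<lambda>H. matrix_inv A ** H)) (at A)"
    using has_derivative_det_mat_1 by (intro diff_chain_at[OF 1]) (simp add: matrix_inv_cancel[OF assms])
  then have "((\<lambda>Z. det A * det (matrix_inv A ** Z)) has_derivative
      (\<lambda>H. det A * trace (matrix_inv A ** H))) (at A)"
    by (intro has_derivative_mult_right) (simp add: o_def)
  moreover have "det A * det (matrix_inv A ** Z) = det Z" for Z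
    using matrix_inv_cancel(1)[OF assms] by (metis det_mul matrix_mul_assoc matrix_mul_lid)
  ultimately show ?thesis by simp
qed

lemma has_derivative_ln_det:
  assumes "A \<in> pd_matrices"
  shows "((\<lambda>Z. ln (det Z)) has_derivative (\<lambda>H. trace (matrix_inv A ** H))) (at A)"
  by (rule has_derivative_eq_rhs[OF has_derivative_ln[OF det_pd_pos[OF assms]
        has_derivative_det[OF pd_invertible[OF assms]]]])
     (use det_pd_pos[OF assms] in \<open>simp add: field_simps\<close>)

lemma matrix_inv_diff:
  assumes "invertible A" "invertible (B :: real^'n^'n)"
  shows "matrix_inv A - matrix_inv B = matrix_inv A ** (B - A) ** matrix_inv B"
  by (simp add: mat_algebra matrix_inv_cancel[OF assms(1)] matrix_inv_cancel[OF assms(2)]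
      flip: matrix_mul_assoc)

text \<open>With \<open>U\<close> and \<open>V\<close> the inverses of \<open>A\<close> and
  \<open>Z\<close>, and \<open>D = Z - A\<close>, the resolvent identity gives the remainder exactly
  as \<open>(U - V) ** D ** U\<close>. A second use of it makes this quadratic in \<open>D\<close>
  once \<open>V\<close> is bounded.\<close>

lemma has_derivative_matrix_inv:
  assumes A: "invertible (A :: real^'n^'n)"
  shows "(matrix_inv has_derivative (\<lambda>H. - (matrix_inv A ** H ** matrix_inv A))) (at A)"
  unfolding has_derivative_at_alt
proof (intro conjI allI impI)
  let ?U = "matrix_inv A"
  show "bounded_linear (\<lambda>H. - (?U ** H ** ?U))"
    by (intro bounded_linear_minus bounded_linear_compose[OF mm.bounded_linear_left mm.bounded_linear_right])
  fix e :: real assume e: "0 < e"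
  have "open {Z :: real^'n^'n. det Z \<noteq> 0}"
    by (intro open_Collect_neq continuous_det continuous_on_const)
  then obtain d0 where d0: "0 < d0" "\<And>Z. dist Z A < d0 \<Longrightarrow> det Z \<noteq> 0"
    using A unfolding open_dist by (auto simp: invertible_det_nz)
  let ?u = "norm ?U"
  \<comment> \<open>The three bounds ensure invertibility of \<open>Z\<close>,
    \<open>?u * norm ?D \<le> 1 / 2\<close>, and \<open>2 * ?u ^ 3 * norm ?D \<le> e\<close>; the
    summands 1 keep the denominators positive.\<close>
  define d where "d = Min {d0, 1 / (2 * ?u + 1), e / (2 * ?u ^ 3 + 1)}"
  have pos: "0 < 2 * ?u + 1" "0 < 2 * ?u ^ 3 + 1" by (auto intro!: add_nonneg_pos)
  have d: "0 < d" "d \<le> d0" "d \<le> 1 / (2 * ?u + 1)" "d \<le> e / (2 * ?u ^ 3 + 1)"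
    using d0(1) e pos by (auto simp: d_def)
  have "norm (matrix_inv Z - ?U - - (?U ** (Z - A) ** ?U)) \<le> e * norm (Z - A)"
    if Z: "norm (Z - A) < d" for Z
  proof -
    let ?V = "matrix_inv Z" and ?D = "Z - A"
    have iZ: "invertible Z"
      using d0(2)[of Z] Z d(2) by (simp add: invertible_det_nz dist_norm)
    have VU: "?U - ?V = ?V ** ?D ** ?U"
      using matrix_inv_diff[OF iZ A] by (simp add: mm.diff_left mm.diff_right) (metis minus_diff_eq)
    have "?u * norm ?D \<le> 1 / 2"
    proof -
      have "?u * norm ?D \<le> ?u * (1 / (2 * ?u + 1))"
        using Z d(3) by (intro mult_left_mono) auto
      also have "\<dots> \<le> 1 / 2" using pos by (simp add: field_simps)
      finally show ?thesis .
    qed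
    then have "norm ?V * (?u * norm ?D) \<le> norm ?V * (1 / 2)"
      by (intro mult_left_mono) auto
    \<comment> \<open>From \<open>V = U - V ** D ** U\<close>; half of \<open>norm ?V\<close> is
      then absorbed on the left.\<close>
    moreover have "norm ?V \<le> ?u + norm ?V * (?u * norm ?D)"
      using norm_triangle_sub[of ?V ?U] norm_matrix_mult3_le[of ?V ?D ?U] VU by (simp add: norm_minus_commute mult_ac)
    ultimately have V: "norm ?V \<le> 2 * ?u" by simp
    have "(?U - ?V) ** ?D ** ?U = ?U ** ?D ** ?U - ?V ** ?D ** ?U"
      by (simp only: mm.diff_left)
    then have "?V - ?U - - (?U ** ?D ** ?U) = (?U - ?V) ** ?D ** ?U"
      unfolding VU[symmetric] by simp
    then have "norm (?V - ?U - - (?U ** ?D ** ?U)) \<le> norm (?U - ?V) * norm ?D * ?u"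
      using norm_matrix_mult3_le by metis
    also have "\<dots> \<le> (2 * ?u * norm ?D * ?u) * norm ?D * ?u"
      unfolding VU by (intro mult_right_mono order_trans[OF norm_matrix_mult3_le]) (use V in auto)
    also have "\<dots> = (2 * ?u ^ 3) * norm ?D * norm ?D"
      by (simp add: power3_eq_cube)
    also have "\<dots> \<le> e * norm ?D"
    proof (intro mult_right_mono)
      have "2 * ?u ^ 3 * norm ?D \<le> 2 * ?u ^ 3 * (e / (2 * ?u ^ 3 + 1))"
        using Z d(4) by (intro mult_left_mono) auto
      also have "\<dots> \<le> e" using pos e by (simp add: field_simps)
      finally show "2 * ?u ^ 3 * norm ?D \<le> e" .
    qed simp
    finally show ?thesis .
  qed
  then show "\<exists>d>0. \<forall>Z. norm (Z - A) < d \<longrightarrow>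
      norm (matrix_inv Z - ?U - - (?U ** (Z - A) ** ?U)) \<le> e * norm (Z - A)"
    using d(1) by blast
qed

text \<open>The derivative of \<open>ln \<circ> det\<close> along the segment from \<open>B\<close> to \<open>A\<close> is strictly decreasing,
  because inverses satisfy \<open>trace ((C\<inverse> - B\<inverse>) ** (C - B)) = - trace (C\<inverse> ** (C - B) ** B\<inverse> ** (C - B))\<close>.\<close>

lemma ln_det_less_tangent:
  assumes A: "A \<in> pd_matrices" and B: "B \<in> pd_matrices" and ne: "A \<noteq> B"
  shows "ln (det A) < ln (det B) + trace (matrix_inv B ** (A - B))"
proof -
  let ?D = "A - B"
  define C where "C s = B + s *\<^sub>R ?D" for s :: real
  have Cp: "C s \<in> pd_matrices" if "0 \<le> s" "s \<le> 1" for s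
    using convexD_alt[OF convex_pd B A that] by (simp add: C_def algebra_simps)
  have der: "((\<lambda>s. ln (det (C s))) has_real_derivative trace (matrix_inv (C s) ** ?D)) (at s)"
    if s: "0 \<le> s" "s \<le> 1" for s
  proof -
    have 1: "(C has_derivative (\<lambda>h. h *\<^sub>R ?D)) (at s)"
      unfolding C_def[abs_def] by (auto intro!: derivative_eq_intros)
    have "((\<lambda>Z. ln (det Z)) \<circ> C has_derivative (\<lambda>H. trace (matrix_inv (C s) ** H)) \<circ> (\<lambda>h. h *\<^sub>R ?D)) (at s)"
      by (rule diff_chain_at[OF 1 has_derivative_ln_det[OF Cp[OF s]]])
    then show ?thesis
      by (simp add: has_field_derivative_def o_def mm.scaleR_right trace_scaleR mult_commute_abs)
  qed
  obtain x where x: "0 < x" "x < 1" "ln (det (C 1)) - ln (det (C 0)) = (1 - 0) * trace (matrix_inv (C x) ** ?D)"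
    using MVT2[of 0 1 "\<lambda>s. ln (det (C s))" "\<lambda>s. trace (matrix_inv (C s) ** ?D)"] der by auto
  have Cx: "C x \<in> pd_matrices" using Cp x by simp
  have "matrix_inv (C x) - matrix_inv B = - x *\<^sub>R (matrix_inv (C x) ** ?D ** matrix_inv B)"
    using matrix_inv_diff[OF pd_invertible[OF Cx] pd_invertible[OF B]]
    by (simp add: C_def mm.scaleR_right mm.scaleR_left mm.minus_left mm.minus_right)
  then have "trace ((matrix_inv (C x) - matrix_inv B) ** ?D)
      = - x * trace (matrix_inv (C x) ** ?D ** matrix_inv B ** ?D)"
    by (simp only: mm.scaleR_left trace_scaleR)
  moreover have "0 < x * trace (matrix_inv (C x) ** ?D ** matrix_inv B ** ?D)"
    using ne by (intro mult_pos_pos[OF x(1)] trace_congruence_pos matrix_inv_pd Cx B subspace_diff subspace_sym_matrices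
        pd_imp_sym[OF A] pd_imp_sym[OF B]) simp
  ultimately have "trace (matrix_inv (C x) ** ?D) < trace (matrix_inv B ** ?D)"
    by (simp only: mm.diff_left trace_sub)
  then show ?thesis using x(3) by (simp add: C_def)
qed

section \<open>The barrier and its conjugate\<close>

text \<open>Within \<open>L\<close> only increments from \<open>L\<close> occur. This permits
  replacing a matrix that represents a derivative by its projection onto \<open>L\<close>.\<close>

lemma has_derivative_within_subspace_cong:
  fixes L :: "'a::real_normed_vector set" and f :: "'a \<Rightarrow> 'b::real_normed_vector"
  assumes L: "subspace L" "x \<in> L" and D: "(f has_derivative D) (at x within L)"
    and E: "bounded_linear E" "\<And>h. h \<in> L \<Longrightarrow> D h = E h"
  shows "(f has_derivative E) (at x within L)"
proof -
  have "D (y - x) = E (y - x)" if "y \<in> L" for y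
    using that L by (intro E(2) subspace_diff)
  then show ?thesis
    using D E(1) unfolding has_derivative_within_alt by simp
qed

lemma orthogonal_projection_exists:
  fixes L :: "'a::euclidean_space set"
  assumes "subspace L"
  obtains P where "bounded_linear P" "\<And>x. P x \<in> L" "\<And>x h. h \<in> L \<Longrightarrow> P x \<bullet> h = x \<bullet> h"
proof -
  obtain B where B: "B \<subseteq> L" "pairwise orthogonal B" "\<And>b. b \<in> B \<Longrightarrow> norm b = 1"
      "independent B" "span B = L"
    using orthonormal_basis_subspace[OF assms] by metis
  have fin: "finite B" using B(4) by (rule independent_imp_finite)
  define P where "P x = (\<Sum>b\<in>B. (x \<bullet> b) *\<^sub>R b)" for x
  show thesis
  proof
    show "bounded_linear P"
      unfolding P_def[abs_def]
      by (intro bounded_linear_sum bounded_linear_compose[OF bounded_linear_scaleR_left]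
          bounded_linear_inner_left)
    show "P x \<in> L" for x
      unfolding P_def using B(1) assms by (intro subspace_sum subspace_scale) auto
    fix x h assume "h \<in> L"
    then have h: "h \<in> span B" using B(5) by simp
    have base: "P x \<bullet> b = x \<bullet> b" if "b \<in> B" for b
    proof -
      have "P x \<bullet> b = (\<Sum>c\<in>B. if c = b then x \<bullet> b else 0)"
        unfolding P_def inner_sum_left using B(2,3) that
        by (intro sum.cong) (auto simp: pairwise_def orthogonal_def dot_square_norm)
      then show ?thesis using fin that by simp
    qed
    show "P x \<bullet> h = x \<bullet> h"
      using h by (induction rule: span_induct_alt) (simp_all add: inner_add_right base)
  qed
qed

section \<open>Interior points of the dual cone\<close>

lemma closed_psd: "closed (psd_matrices :: (real^'n^'n) set)"
proof -
  have "linear (\<lambda>A :: real^'n^'n. v \<bullet> (A *v v))" for v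
    by (intro linearI) (simp_all add: matrix_vector_mult_add_rdistrib inner_add_right
        flip: scaleR_matrix_vector_assoc)
  then have "closed {A :: real^'n^'n. 0 \<le> v \<bullet> (A *v v)}" for v
    by (intro closed_Collect_le continuous_on_const linear_continuous_on)
       (simp add: linear_conv_bounded_linear)
  then have "closed (sym_matrices \<inter> (\<Inter>v. {A :: real^'n^'n. 0 \<le> v \<bullet> (A *v v)}))"
    by (intro closed_Int closed_subspace[OF subspace_sym_matrices] closed_INT) auto
  moreover have "psd_matrices = sym_matrices \<inter> (\<Inter>v. {A :: real^'n^'n. 0 \<le> v \<bullet> (A *v v)})"
    by (auto simp: psd_matrices_def)
  ultimately show ?thesis by simp
qed

text \<open>The constant is the minimum of \<open>V \<bullet> X\<close> over semidefinite
  \<open>X\<close> of norm 1, a compact set on which it is positive.\<close>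

lemma pd_trace_coercive:
  assumes V: "(V :: real^'n^'n) \<in> pd_matrices"
  obtains c where "0 < c" "\<And>X. X \<in> psd_matrices \<Longrightarrow> c * norm X \<le> V \<bullet> X"
proof (cases "psd_matrices \<inter> sphere 0 1 = ({} :: (real^'n^'n) set)")
  case True
  have "norm X = 0" if "X \<in> psd_matrices" for X :: "real^'n^'n"
  proof (rule ccontr)
    assume "norm X \<noteq> 0"
    then have "X /\<^sub>R norm X \<in> psd_matrices \<inter> sphere 0 1"
      using that by (auto simp: psd_matrices_def subspace_scale[OF subspace_sym_matrices]
          simp flip: scaleR_matrix_vector_assoc)
    with True show False by blast
  qed
  then have "X = 0" if "X \<in> psd_matrices" for X :: "real^'n^'n"
    using that by simp
  then have "1 * norm X \<le> V \<bullet> X" if "X \<in> psd_matrices" for X :: "real^'n^'n"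
    using that by fastforce
  then show thesis using that zero_less_one by blast
next
  case False
  moreover have "compact (psd_matrices \<inter> sphere 0 1 :: (real^'n^'n) set)"
    using closed_psd compact_sphere by (rule closed_Int_compact)
  moreover have "continuous_on (psd_matrices \<inter> sphere 0 1) (\<lambda>X. V \<bullet> X)"
    by (intro continuous_on_inner continuous_on_id continuous_on_const)
  ultimately obtain X0 where X0: "X0 \<in> psd_matrices \<inter> sphere 0 1"
      "\<And>X. X \<in> psd_matrices \<inter> sphere 0 1 \<Longrightarrow> V \<bullet> X0 \<le> V \<bullet> X"
    using continuous_attains_inf[of "psd_matrices \<inter> sphere 0 1" "\<lambda>X. V \<bullet> X"] by blast
  show thesis
  proof
    have "X0 \<noteq> 0" using X0(1) by auto
    then show "0 < V \<bullet> X0"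
      using trace_pd_mult_pos[OF V, of X0] X0(1) trace_mult_eq_inner[OF pd_imp_sym[OF V], of X0]
      by simp
    fix X :: "real^'n^'n" assume X: "X \<in> psd_matrices"
    show "V \<bullet> X0 * norm X \<le> V \<bullet> X"
    proof (cases "X = 0")
      case False
      have "X /\<^sub>R norm X \<in> psd_matrices \<inter> sphere 0 1"
        using False X by (auto simp: psd_matrices_def subspace_scale[OF subspace_sym_matrices]
            simp flip: scaleR_matrix_vector_assoc)
      from X0(2)[OF this] False show ?thesis by (simp add: field_simps)
    qed simp
  qed
qed

text \<open>On the cone \<open>S\<close> acts like \<open>V\<close>, whose value at \<open>X\<close>
  is at least \<open>c * norm X\<close>. By Cauchy-Schwarz a perturbation of norm below
  \<open>c\<close> cannot destroy nonnegativity.\<close>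

lemma projected_inverse_in_interior_dual:
  fixes L :: "(real^'n^'n) set"
  assumes L: "subspace L" "L \<subseteq> sym_matrices" and V: "V \<in> pd_matrices"
    and S: "S \<in> L" "\<And>H. H \<in> L \<Longrightarrow> S \<bullet> H = V \<bullet> H"
  shows "S \<in> interior_in L (dual_cone_in L (psd_section L))"
proof -
  obtain c where c: "0 < c" "\<And>X. X \<in> psd_matrices \<Longrightarrow> c * norm X \<le> V \<bullet> X"
    using pd_trace_coercive[OF V] by blast
  have "T \<in> dual_cone_in L (psd_section L)" if T: "T \<in> L" "norm (T - S) < c" for T
  proof -
    have "0 \<le> trace (T ** X)" if X: "X \<in> psd_section L" for X
    proof -
      have "\<bar>(T - S) \<bullet> X\<bar> \<le> norm (T - S) * norm X"
        by (rule Cauchy_Schwarz_ineq2)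
      also have "\<dots> \<le> c * norm X" using T by (intro mult_right_mono) auto
      also have "\<dots> \<le> V \<bullet> X" using X by (intro c(2)) (simp add: psd_section_def)
      also have "\<dots> = S \<bullet> X" using X by (simp add: S(2) psd_section_def)
      finally show ?thesis
        using T(1) L(2) by (simp add: trace_mult_eq_inner subset_iff inner_diff_left)
    qed
    with T show ?thesis by (simp add: dual_cone_in_def)
  qed
  moreover have "dual_cone_in L (psd_section L) \<subseteq> L"
    by (auto simp: dual_cone_in_def)
  ultimately show ?thesis
    using c(1) S(1) by (subst interior_in_iff) auto
qed

section \<open>Gradient of the conjugate barrier\<close>

text \<open>The gap \<open>q\<close> between the tangent at \<open>Y\<close> and
  \<open>ln (det X)\<close> is convex, vanishes at \<open>Y\<close> and is positive elsewhere. Its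
  minimum on a small sphere around \<open>Y\<close> therefore forces at least linear growth
  outside.\<close>

lemma ln_det_tangent_gap:
  assumes Y: "(Y :: real^'n^'n) \<in> pd_matrices" and e: "0 < e"
  obtains m where "0 < m" "\<And>X. X \<in> pd_matrices \<Longrightarrow> e \<le> norm (X - Y) \<Longrightarrow>
    ln (det X) + m * norm (X - Y) \<le> ln (det Y) + trace (matrix_inv Y ** (X - Y))"
proof -
  define q where "q X = ln (det Y) + trace (matrix_inv Y ** (X - Y)) - ln (det X)" for X
  obtain d where d: "0 < d" "\<And>B. B \<in> sym_matrices \<Longrightarrow> norm (B - Y) < d \<Longrightarrow> B \<in> pd_matrices"
    using pd_open_in_sym[OF Y] by blast
  \<comment> \<open>\<open>r \<le> e\<close> places the sphere between \<open>Y\<close> and every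
    \<open>X\<close> considered; \<open>r < d\<close> keeps the symmetric part of the sphere inside
    the positive definite cone.\<close>
  define r where "r = min e (d / 2)"
  have r: "0 < r" "r \<le> e" "r < d" using e d(1) by (auto simp: r_def)
  define T where "T = sym_matrices \<inter> sphere Y r"
  have Tpd: "T \<subseteq> pd_matrices"
    using d(2) r(3) by (auto simp: T_def dist_norm norm_minus_commute)
  have qpos: "0 < q X" if "X \<in> T" for X
    using ln_det_less_tangent[of X Y] Y Tpd that r(1) by (force simp: q_def T_def)
  have on_ray: "\<exists>Z\<in>T. norm (X - Y) * q Z \<le> r * q X"
    if X: "X \<in> pd_matrices" "e \<le> norm (X - Y)" for X
  proof -
    define s where "s = r / norm (X - Y)"
    have n: "0 < norm (X - Y)" "r \<le> norm (X - Y)" using X e r by linarith+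
    have s: "0 < s" "s \<le> 1" using n r(1) by (auto simp: s_def)
    define Z where "Z = Y + s *\<^sub>R (X - Y)"
    have Zpd: "Z \<in> pd_matrices"
      using convexD_alt[OF convex_pd Y X(1), of s] s by (simp add: Z_def algebra_simps)
    have ZT: "Z \<in> T"
      using pd_imp_sym[OF Zpd] n r(1) by (simp add: T_def Z_def s_def dist_norm)
    let ?V = "matrix_inv Z" and ?D = "X - Y"
    \<comment> \<open>Concavity comes from the tangent at \<open>Z\<close>, taken at
      \<open>X\<close> with weight \<open>s\<close> and at \<open>Y\<close> with weight
      \<open>1 - s\<close>: the linear terms cancel.\<close>
    have tangent: "ln (det M) \<le> ln (det Z) + trace (?V ** (M - Z))" if "M \<in> pd_matrices" for M
      using ln_det_less_tangent[OF that Zpd] by (cases "M = Z") (auto simp: mat_algebra)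
    have "X - Z = (1 - s) *\<^sub>R ?D" "Y - Z = (- s) *\<^sub>R ?D" "Z - Y = s *\<^sub>R ?D"
      by (simp_all add: Z_def algebra_simps)
    then have "ln (det X) \<le> ln (det Z) + (1 - s) * trace (?V ** ?D)"
      "ln (det Y) \<le> ln (det Z) + (- s) * trace (?V ** ?D)"
      and q: "q Z = ln (det Y) + s * trace (matrix_inv Y ** ?D) - ln (det Z)"
      using tangent[OF X(1)] tangent[OF Y] by (simp_all only: q_def mm.scaleR_right trace_scaleR)
    then have "s * ln (det X) + (1 - s) * ln (det Y)
        \<le> s * (ln (det Z) + (1 - s) * trace (?V ** ?D)) + (1 - s) * (ln (det Z) + (- s) * trace (?V ** ?D))"
      using s by (intro add_mono mult_left_mono) auto
    also have "\<dots> = ln (det Z)" by (simp add: algebra_simps)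
    finally have "q Z \<le> s * q X"
      unfolding q by (simp add: q_def algebra_simps)
    then have "norm ?D * q Z \<le> r * q X"
      using n(1) by (simp add: s_def field_simps)
    with ZT show ?thesis by blast
  qed
  obtain m where m: "0 < m" "\<And>Z. Z \<in> T \<Longrightarrow> m \<le> q Z"
  proof (cases "T = {}")
    case True
    then show thesis using that[of 1] by simp
  next
    case False
    have "compact T"
      unfolding T_def by (intro closed_Int_compact closed_subspace subspace_sym_matrices compact_sphere)
    moreover have "continuous_on T q"
      unfolding q_def
      using det_pd_pos Tpd
      by (intro continuous_intros continuous_det linear_continuous_on[OF bounded_linear_compose[OF
            bounded_linear_trace mm.bounded_linear_right], THEN continuous_on_compose2[where t = UNIV]])
         force+
    ultimately obtain Z where "Z \<in> T" "\<forall>X\<in>T. q Z \<le> q X"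
      using continuous_attains_inf[OF _ False] by blast
    then show thesis using that[of "q Z"] qpos by blast
  qed
  show thesis
  proof
    show "0 < m / r" using m r by simp
    fix X assume X: "X \<in> pd_matrices" "e \<le> norm (X - Y)"
    obtain Z where Z: "Z \<in> T" "norm (X - Y) * q Z \<le> r * q X" using on_ray[OF X] by blast
    have "norm (X - Y) * m \<le> norm (X - Y) * q Z" using m(2)[OF Z(1)] by (intro mult_left_mono) auto
    with Z(2) have "m / r * norm (X - Y) \<le> q X" using r(1) by (simp add: field_simps)
    then show "ln (det X) + m / r * norm (X - Y) \<le> ln (det Y) + trace (matrix_inv Y ** (X - Y))"
      by (simp add: q_def)
  qed
qed

text \<open>At \<open>S\<close> the supremum is attained at \<open>Y\<close>. For nearby
  \<open>T\<close> it exceeds the value at \<open>Y\<close> by at most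
  \<open>e * norm (T - S)\<close>, so the affine function \<open>T \<mapsto> ?g T Y\<close> is its
  first-order approximation; no maximiser for \<open>T\<close> has to be found.\<close>

lemma grad_conjugate_barrier:
  fixes L :: "(real^'n^'n) set"
  assumes L: "subspace L" "L \<subseteq> sym_matrices" "mat 1 \<in> L" and Y: "Y \<in> pd_matrices" "Y \<in> L"
    and S: "S \<in> L" "\<And>H. H \<in> L \<Longrightarrow> S \<bullet> H = matrix_inv Y \<bullet> H"
  shows "grad_in L (conjugate_barrier L) S = - Y"
proof (rule grad_in_eqI[OF L(1,2) S(1)])
  show "- Y \<in> L" using Y L by (simp add: subspace_neg)
  let ?K = "pd_matrices \<inter> L" and ?f = "conjugate_barrier L"
  let ?g = "\<lambda>T X. ln (det X) - T \<bullet> X"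
  have f: "?f T = (SUP X\<in>?K. ?g T X)" if "T \<in> L" for T
    using that L(2) by (simp add: conjugate_barrier_def interior_psd_section[OF L] log_det_barrier_def
        trace_mult_eq_inner subset_iff)
  have SV: "S \<bullet> X - S \<bullet> Y = trace (matrix_inv Y ** (X - Y))" if "X \<in> L" for X
    using that Y L(1) pd_imp_sym[OF matrix_inv_pd[OF Y(1)]]
    by (simp add: S(2) trace_mult_eq_inner inner_diff_right)
  have near: "\<exists>m>0. \<forall>T\<in>L. norm (T - S) < m \<longrightarrow>
      ?g T Y \<le> ?f T \<and> ?f T \<le> ?g T Y + e * norm (T - S)" if e: "0 < e" for e
  proof -
    obtain m where m: "0 < m" "\<And>X. X \<in> pd_matrices \<Longrightarrow> e \<le> norm (X - Y) \<Longrightarrow>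
        ln (det X) + m * norm (X - Y) \<le> ln (det Y) + trace (matrix_inv Y ** (X - Y))"
      using ln_det_tangent_gap[OF Y(1) e] by blast
    have "?g T Y \<le> ?f T \<and> ?f T \<le> ?g T Y + e * norm (T - S)" if T: "T \<in> L" "norm (T - S) < m" for T
    proof -
      have ub: "?g T X \<le> ?g T Y + e * norm (T - S)" if X: "X \<in> ?K" for X
      proof -
        have CS: "- ((T - S) \<bullet> (X - Y)) \<le> norm (T - S) * norm (X - Y)"
          using Cauchy_Schwarz_ineq2[of "T - S" "X - Y"] by linarith
        have eq: "T \<bullet> X = T \<bullet> Y + (T - S) \<bullet> (X - Y) + trace (matrix_inv Y ** (X - Y))"
          using X by (simp add: inner_diff_left inner_diff_right flip: SV)
        show ?thesis
        \<comment> \<open>For distant \<open>X\<close> the linear gap outweighs the perturbation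
          \<open>norm (T - S) * norm (X - Y)\<close>; for close \<open>X\<close> the perturbation
          itself is at most \<open>e * norm (T - S)\<close>.\<close>
        proof (cases "e \<le> norm (X - Y)")
          case True
          have "norm (T - S) * norm (X - Y) \<le> m * norm (X - Y)"
            using T by (intro mult_right_mono) auto
          moreover have "0 \<le> e * norm (T - S)" using e by simp
          ultimately show ?thesis using m(2)[of X] X True CS eq by auto
        next
          case False
          then have "norm (T - S) * norm (X - Y) \<le> e * norm (T - S)"
            by (subst mult.commute) (intro mult_right_mono, auto)
          moreover have "ln (det X) \<le> ln (det Y) + trace (matrix_inv Y ** (X - Y))"
            using ln_det_less_tangent[of X Y] X Y(1) by (cases "X = Y") (auto simp: mat_algebra)
          ultimately show ?thesis using CS eq by auto
        qed
      qed
      have Yin: "Y \<in> ?K" using Y by simp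
      have "bdd_above (?g T ` ?K)" using ub by (intro bdd_aboveI2) 
      then have "?g T Y \<le> ?f T" unfolding f[OF T(1)] by (intro cSUP_upper Yin)
      moreover have "?f T \<le> ?g T Y + e * norm (T - S)"
        unfolding f[OF T(1)] using Yin ub by (intro cSUP_least) auto
      ultimately show ?thesis ..
    qed
    with m(1) show ?thesis by blast
  qed
  have "(?f has_derivative (\<lambda>H. - (Y \<bullet> H))) (at S within L)"
    unfolding has_derivative_within_alt
  proof (intro conjI allI impI)
    show "bounded_linear (\<lambda>H. - (Y \<bullet> H))"
      by (intro bounded_linear_minus bounded_linear_inner_right)
    fix e :: real assume "0 < e"
    from near[OF this] obtain m where m: "0 < m" "\<And>T. T \<in> L \<Longrightarrow> norm (T - S) < m \<Longrightarrow>
      ?g T Y \<le> ?f T \<and> ?f T \<le> ?g T Y + e * norm (T - S)" by blast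
    \<comment> \<open>\<open>m(2)\<close> at \<open>T = S\<close> identifies \<open>?f S\<close>
      with \<open>?g S Y\<close>.\<close>
    have "norm (?f T - ?f S - - (Y \<bullet> (T - S))) \<le> e * norm (T - S)" if "T \<in> L" "norm (T - S) < m" for T
      using m(2)[OF that] m(2)[OF S(1)] m(1) by (simp add: inner_diff_right inner_commute[of Y])
    then show "\<exists>d>0. \<forall>T\<in>L. norm (T - S) < d \<longrightarrow>
        norm (?f T - ?f S - - (Y \<bullet> (T - S))) \<le> e * norm (T - S)"
      using m(1) by blast
  qed
  moreover have "(\<lambda>H. - (Y \<bullet> H)) = (\<lambda>H. trace (- Y ** H))"
    using pd_imp_sym[OF Y(1)] by (simp add: mm.minus_left trace_minus trace_mult_eq_inner)
  ultimately show "(?f has_derivative (\<lambda>H. trace (- Y ** H))) (at S within L)"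
    by simp
qed

section \<open>Gradient and Hessian of the barrier on the subspace\<close>

text \<open>\<open>matrix_inv X\<close> may lie outside \<open>L\<close>, so its representative
  \<open>g\<close> in \<open>L\<close> takes its place; the two agree on all directions of
  \<open>L\<close>.\<close>

lemma grad_log_det_barrier:
  fixes L :: "(real^'n^'n) set"
  assumes L: "subspace L" "L \<subseteq> sym_matrices" and X: "X \<in> pd_matrices" "X \<in> L"
    and g: "g \<in> L" "\<And>H. H \<in> L \<Longrightarrow> g \<bullet> H = matrix_inv X \<bullet> H"
  shows "grad_in L log_det_barrier X = - g"
proof (rule grad_in_eqI[OF L X(2)])
  show g': "- g \<in> L" using g L by (simp add: subspace_neg)
  have "(log_det_barrier has_derivative (\<lambda>H. - trace (matrix_inv X ** H))) (at X within L)"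
    unfolding log_det_barrier_def[abs_def]
    by (rule has_derivative_minus[OF has_derivative_at_withinI[OF has_derivative_ln_det[OF X(1)]]])
  then show "(log_det_barrier has_derivative (\<lambda>H. trace (- g ** H))) (at X within L)"
  proof (rule has_derivative_within_subspace_cong[OF L(1) X(2)])
    show "bounded_linear (\<lambda>H. trace (- g ** H))"
      by (rule bounded_linear_compose[OF bounded_linear_trace mm.bounded_linear_right])
    fix H assume "H \<in> L"
    then show "- trace (matrix_inv X ** H) = trace (- g ** H)"
      using g(2)[of H] subsetD[OF L(2) g(1)] pd_imp_sym[OF matrix_inv_pd[OF X(1)]]
      by (simp add: mm.minus_left trace_minus trace_mult_eq_inner)
  qed
qed

text \<open>Near \<open>W\<close> in \<open>L\<close> the gradient is
  \<open>- P (matrix_inv X)\<close>, a bounded linear map after the inverse, so the chain rule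
  applies.\<close>

lemma hess_log_det_barrier:
  fixes L :: "(real^'n^'n) set"
  assumes L: "subspace L" "L \<subseteq> sym_matrices" and W: "W \<in> pd_matrices" "W \<in> L" and H: "H \<in> L"
    and P: "bounded_linear P" "\<And>x. P x \<in> L" "\<And>x h. h \<in> L \<Longrightarrow> P x \<bullet> h = x \<bullet> h"
  shows "hess_in L log_det_barrier W H = P (matrix_inv W ** H ** matrix_inv W)"
proof (rule hess_in_eqI[OF L(1) W(2) H])
  obtain d where d: "0 < d" "\<And>B. B \<in> sym_matrices \<Longrightarrow> norm (B - W) < d \<Longrightarrow> B \<in> pd_matrices"
    using pd_open_in_sym[OF W(1)] by blast
  have "((\<lambda>X. - P (matrix_inv X)) has_derivative
      (\<lambda>H. - P (- (matrix_inv W ** H ** matrix_inv W)))) (at W within L)"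
    by (rule has_derivative_minus[OF bounded_linear.has_derivative[OF P(1)
          has_derivative_at_withinI[OF has_derivative_matrix_inv[OF pd_invertible[OF W(1)]]]]])
  then have "((\<lambda>X. - P (matrix_inv X)) has_derivative
      (\<lambda>H. P (matrix_inv W ** H ** matrix_inv W))) (at W within L)"
    by (simp add: linear_neg[OF bounded_linear.linear[OF P(1)]])
  then show "(grad_in L log_det_barrier has_derivative
      (\<lambda>H. P (matrix_inv W ** H ** matrix_inv W))) (at W within L)"
  proof (rule has_derivative_transform_within[OF _ d(1) W(2)])
    fix X assume "X \<in> L" "dist X W < d"
    then have "X \<in> pd_matrices" using d(2)[of X] L(2) by (auto simp: dist_norm)
    then show "- P (matrix_inv X) = grad_in L log_det_barrier X"
      using grad_log_det_barrier[OF L _ \<open>X \<in> L\<close> P(2,3)] by simp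
  qed
qed

section \<open>Scaling points near the identity\<close>

text \<open>The two traces on the left reduce to \<open>- trace (E ** W ** W)\<close> and \<open>trace (E ** U)\<close>; the right-hand
  side arises because \<open>W\<^sup>2 - 3 W + 3 I - U = U (W - I)\<^sup>3\<close> and \<open>E\<close> is orthogonal to \<open>I\<close> and \<open>W\<close>.\<close>

lemma defect_identity:
  fixes U W V Y :: "real^'n^'n"
  assumes inv: "U ** W = mat 1" "W ** U = mat 1" "V ** Y = mat 1" "Y ** V = mat 1"
  defines "E \<equiv> U ** Y ** U - mat 1" and "N \<equiv> W - mat 1"
  assumes t1: "trace E = 0" and tW: "trace (E ** W) = 0" and tY: "trace (E ** Y) = 0"
    and tU: "trace U = trace (V ** W)"
  shows "trace (E ** W ** E ** W) + trace (E ** (W ** V ** W) ** E ** U) = - trace (E ** (U ** N ** N ** N))"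
proof -
  let ?A = "W ** V ** W"
  note assoc = matrix_mul_assoc[symmetric]
  have c: "U ** (W ** Z) = Z" "W ** (U ** Z) = Z" "V ** (Y ** Z) = Z" "Y ** (V ** Z) = Z"
    for Z :: "real^'n^'n"
    by (simp_all add: matrix_mul_assoc inv)
  have "W ** E ** W = Y - W ** W"
    by (simp add: E_def mm.diff_left mm.diff_right assoc c inv)
  then have "E ** W ** E ** W = E ** Y - E ** W ** W"
    by (metis matrix_mul_assoc mm.diff_right)
  then have 1: "trace (E ** W ** E ** W) = - trace (E ** W ** W)"
    by (simp add: trace_sub tY)
  have EA: "E ** ?A = mat 1 - ?A" and AE: "?A ** E = mat 1 - ?A"
    by (simp_all add: E_def mm.diff_left mm.diff_right assoc c inv)
  have "E ** ?A ** E ** U = E ** U - U + ?A ** U"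
    unfolding EA by (simp only: mm.diff_left AE matrix_mul_lid) (simp add: algebra_simps)
  \<comment> \<open>With \<open>tU\<close> and cyclicity of the trace, the last two terms above
    cancel.\<close>
  moreover have "trace (?A ** U) = trace U"
    unfolding tU by (simp add: assoc inv) (metis trace_mul_sym)
  ultimately have 2: "trace (E ** ?A ** E ** U) = trace (E ** U)"
    by (simp add: trace_add trace_sub)
  have UN: "U ** N = mat 1 - U"
    by (simp add: N_def mm.diff_right inv)
  then have UNN: "(mat 1 - U) ** N = N - (mat 1 - U)"
    by (simp add: mm.diff_left)
  then have "U ** N ** N ** N = N ** N - (N - (mat 1 - U))"
    unfolding UN by (simp only: UNN mm.diff_left[of N])
  moreover have "E ** (N ** N) = E ** W ** W - E ** W - (E ** W - E)"
    by (simp only: N_def mm.diff_left mm.diff_right matrix_mul_assoc matrix_mul_lid matrix_mul_rid)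
  moreover have "E ** N = E ** W - E"
    by (simp add: N_def mm.diff_right)
  ultimately have "trace (E ** (U ** N ** N ** N)) =
      trace (E ** W ** W) - 3 * trace (E ** W) + 3 * trace E - trace (E ** U)"
    by (simp only: mm.diff_right matrix_mul_rid trace_sub)
  then show ?thesis by (simp add: 1 2 t1 tW)
qed

text \<open>For \<open>P\<close> and \<open>R\<close> near \<open>mat 1\<close> the trace is close
  to \<open>trace (E ** E)\<close>, the squared norm. Replacing first \<open>P\<close> and then
  \<open>R\<close> by \<open>mat 1\<close> produces the two error terms.\<close>

lemma trace_sandwich_lower_bound:
  fixes E P R :: "real^'n^'n"
  assumes E: "E \<in> sym_matrices"
  shows "(norm E)\<^sup>2 * (1 - norm (P - mat 1) * norm R - norm (R - mat 1)) \<le> trace (E ** P ** E ** R)"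
proof -
  have tr: "trace (E ** Z) = E \<bullet> Z" for Z
    by (rule trace_mult_eq_inner[OF E])
  have "E ** P ** E ** R = E ** ((P - mat 1) ** E ** R) + E ** (E ** (R - mat 1)) + E ** E"
    by (simp add: mm.diff_left mm.diff_right matrix_mul_assoc)
  then have eq: "trace (E ** P ** E ** R) = E \<bullet> ((P - mat 1) ** E ** R) + E \<bullet> (E ** (R - mat 1)) + (norm E)\<^sup>2"
    by (simp add: trace_add tr power2_norm_eq_inner)
  have "\<bar>E \<bullet> ((P - mat 1) ** E ** R)\<bar> \<le> norm E * (norm (P - mat 1) * norm E * norm R)"
    by (rule order_trans[OF Cauchy_Schwarz_ineq2 mult_left_mono])
       (simp_all add: norm_matrix_mult3_le)
  moreover have "\<bar>E \<bullet> (E ** (R - mat 1))\<bar> \<le> norm E * (norm E * norm (R - mat 1))"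
    by (rule order_trans[OF Cauchy_Schwarz_ineq2 mult_left_mono]) (auto intro!: norm_matrix_mult_le)
  ultimately show ?thesis unfolding eq
    by (simp add: power2_eq_square algebra_simps abs_le_iff)
qed

section \<open>Estimates for scaling points\<close>

text \<open>Matrix form of \<open>w + 1 / w \<ge> 2\<close>: with \<open>U\<close> the inverse,
  \<open>(mat 1 - U) ** W ** (mat 1 - U)\<close> is semidefinite and equals
  \<open>W + U - 2 *\<^sub>R mat 1\<close>.\<close>

lemma trace_plus_trace_inverse_ge:
  assumes W: "(W :: real^'n^'n) \<in> pd_matrices"
  shows "2 * trace (mat 1 :: real^'n^'n) \<le> trace W + trace (matrix_inv W)"
proof -
  let ?U = "matrix_inv W"
  have "(mat 1 - ?U) ** W ** (mat 1 - ?U) \<in> psd_matrices"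
    by (intro psd_congruence pd_imp_psd W subspace_diff subspace_sym_matrices pd_imp_sym
        matrix_inv_pd mat_1_pd)
  then have "0 \<le> trace (mat 1 ** ((mat 1 - ?U) ** W ** (mat 1 - ?U)))"
    by (intro trace_psd_mult_nonneg pd_imp_psd[OF mat_1_pd])
  also have "(mat 1 - ?U) ** W ** (mat 1 - ?U) = W - mat 1 - (mat 1 - ?U)"
    by (simp add: mm.diff_left mm.diff_right pd_inv_cancel[OF W])
  also have "trace (mat 1 ** (W - mat 1 - (mat 1 - ?U))) = trace W + trace ?U - 2 * trace (mat 1 :: real^'n^'n)"
    by (simp only: matrix_mul_lid trace_sub)
  finally show ?thesis by simp
qed

text \<open>The equations \<open>F''(W)[I] = P(Y^-1)\<close> and \<open>F''(W)[Y] = I\<close>,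
  tested against every direction of \<open>L\<close>, so that the projection disappears.\<close>

definition scaling_point :: "(real^'n^'n) set \<Rightarrow> real^'n^'n \<Rightarrow> real^'n^'n \<Rightarrow> bool" where
  "scaling_point L Y W \<longleftrightarrow> W \<in> pd_matrices \<inter> L \<and>
     (\<forall>H\<in>L. trace (matrix_inv W ** matrix_inv W ** H) = trace (matrix_inv Y ** H) \<and>
            trace (matrix_inv W ** Y ** matrix_inv W ** H) = trace H)"

text \<open>The first equation at \<open>H = mat 1\<close> fixes the norm of \<open>U\<close>, the
  inverse of \<open>W\<close>; the second at \<open>H = W\<close> gives
  \<open>trace (U ** Y) = trace W\<close>. With the trace inequality above this bounds
  \<open>trace U\<close> from below, hence the distance of \<open>U\<close> from
  \<open>mat 1\<close> from above.\<close>

lemma scaling_point_near_mat_1: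
  assumes I: "mat 1 \<in> L" and Y: "Y \<in> pd_matrices" and sp: "scaling_point L Y W"
  shows "(norm (matrix_inv W - mat 1))\<^sup>2 \<le>
    trace (matrix_inv Y) - trace (mat 1 :: real^'n^'n) + sqrt (trace (matrix_inv Y)) * norm (Y - mat 1 :: real^'n^'n)"
proof -
  let ?U = "matrix_inv W"
  have W: "W \<in> pd_matrices" "W \<in> L" using sp unfolding scaling_point_def by blast+
  note c = pd_inv_cancel[OF W(1)]
  have U: "?U \<in> sym_matrices" by (intro pd_imp_sym matrix_inv_pd W)
  have sq: "(norm ?U)\<^sup>2 = trace (matrix_inv Y)"
    using sp I trace_mult_eq_inner[OF U, of ?U] by (force simp: scaling_point_def power2_norm_eq_inner)
  have "trace (?U ** Y ** ?U ** W) = trace W"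
    using sp W by (auto simp: scaling_point_def)
  then have "trace (?U ** (Y - mat 1)) = trace W - trace ?U"
    by (simp add: c mm.diff_right trace_sub flip: matrix_mul_assoc)
  moreover have "\<bar>trace (?U ** (Y - mat 1))\<bar> \<le> norm ?U * norm (Y - mat 1)"
    unfolding trace_mult_eq_inner[OF U] by (rule Cauchy_Schwarz_ineq2)
  ultimately have "2 * trace (mat 1 :: real^'n^'n) \<le> 2 * trace ?U + norm ?U * norm (Y - mat 1)"
    using trace_plus_trace_inverse_ge[OF W(1)] by linarith
  moreover have "norm ?U = sqrt (trace (matrix_inv Y))"
    by (simp flip: sq)
  moreover have "(norm (?U - mat 1))\<^sup>2 = trace (matrix_inv Y) - 2 * trace ?U + trace (mat 1 :: real^'n^'n)"
    by (simp add: power2_norm_eq_inner inner_diff_left inner_diff_right inner_commute[of ?U "mat 1"]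
        flip: trace_eq_inner_mat_1 sq)
  ultimately show ?thesis by simp
qed

text \<open>By \<open>c1\<close> and \<open>c2\<close> each trace on the left of
  \<open>defect_identity\<close> is at least half of the squared norm of \<open>E\<close>. The right
  side is linear in \<open>E\<close> and cubic in \<open>W - mat 1\<close>, so one factor
  \<open>norm E\<close> cancels.\<close>

lemma scaling_point_defect_le:
  fixes W Y :: "real^'n^'n"
  assumes L: "subspace L" "mat 1 \<in> L" and Y: "Y \<in> pd_matrices" "Y \<in> L" and sp: "scaling_point L Y W"
  defines "U \<equiv> matrix_inv W" and "A \<equiv> W ** matrix_inv Y ** W"
  defines "E \<equiv> U ** Y ** U - mat 1"
  assumes c1: "norm (W - mat 1) * norm W + norm (W - mat 1) \<le> 1 / 2"
    and c2: "norm (A - mat 1) * norm U + norm (U - mat 1) \<le> 1 / 2"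
  shows "norm E \<le> norm U * norm (W - mat 1) ^ 3"
proof -
  let ?N = "W - mat 1"
  have W: "W \<in> pd_matrices" "W \<in> L" using sp unfolding scaling_point_def by blast+
  have h1: "trace (U ** U ** H) = trace (matrix_inv Y ** H)" and h2: "trace (U ** Y ** U ** H) = trace H"
    if "H \<in> L" for H using sp that unfolding scaling_point_def U_def by blast+
  note c = pd_inv_cancel[OF W(1), folded U_def] pd_inv_cancel[OF Y(1)]
  have U: "U \<in> sym_matrices" unfolding U_def by (intro pd_imp_sym matrix_inv_pd W)
  have E: "E \<in> sym_matrices"
    unfolding E_def by (intro subspace_diff subspace_sym_matrices sym_matrices_congruence U pd_imp_sym Y mat_1_pd)
  have tE: "trace (E ** H) = 0" if "H \<in> L" for H
    using h2[OF that] by (simp only: E_def mm.diff_left trace_sub matrix_mul_lid)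
  \<comment> \<open>The first scaling equation at \<open>H = W\<close> yields the trace condition on
    \<open>U\<close>.\<close>
  have "U ** U ** W = U ** (U ** W)" by (rule matrix_mul_assoc[symmetric])
  also have "\<dots> = U" unfolding c(2) by (rule matrix_mul_rid)
  finally have tU: "trace U = trace (matrix_inv Y ** W)"
    using h1[OF W(2)] by (rule subst)
  have "trace (E ** W ** E ** W) + trace (E ** A ** E ** U) = - trace (E ** (U ** ?N ** ?N ** ?N))"
    unfolding A_def E_def
    by (rule defect_identity[OF c(2,1,4,3)])
       (use tE[OF L(2), unfolded E_def] in simp, fact tE[OF W(2), unfolded E_def], fact tE[OF Y(2), unfolded E_def], fact tU)
  moreover have "(norm E)\<^sup>2 * (1 / 2) \<le> trace (E ** W ** E ** W)"
  proof -
    have "(norm E)\<^sup>2 * (1 / 2) \<le> (norm E)\<^sup>2 * (1 - norm (W - mat 1) * norm W - norm (W - mat 1))"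
      by (rule mult_left_mono) (use c1 in linarith, rule zero_le_power2)
    also have "\<dots> \<le> trace (E ** W ** E ** W)"
      by (rule trace_sandwich_lower_bound[OF E])
    finally show ?thesis .
  qed
  moreover have "(norm E)\<^sup>2 * (1 / 2) \<le> trace (E ** A ** E ** U)"
  proof -
    have "(norm E)\<^sup>2 * (1 / 2) \<le> (norm E)\<^sup>2 * (1 - norm (A - mat 1) * norm U - norm (U - mat 1))"
      by (rule mult_left_mono) (use c2 in linarith, rule zero_le_power2)
    also have "\<dots> \<le> trace (E ** A ** E ** U)"
      by (rule trace_sandwich_lower_bound[OF E])
    finally show ?thesis .
  qed
  moreover have "\<bar>trace (E ** (U ** ?N ** ?N ** ?N))\<bar> \<le> norm E * (norm U * norm ?N * norm ?N * norm ?N)"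
    unfolding trace_mult_eq_inner[OF E]
    by (intro order_trans[OF Cauchy_Schwarz_ineq2] mult_left_mono norm_ge_zero
        order_trans[OF norm_matrix_mult_le mult_right_mono[OF norm_matrix_mult3_le]])
  ultimately have "norm E * norm E \<le> norm E * (norm U * norm ?N ^ 3)"
    unfolding power2_eq_square power3_eq_cube mult.assoc by linarith
  then show ?thesis
    by (cases "E = 0") (simp, rule mult_left_le_imp_le, assumption, simp)
qed

section \<open>Second-order limit along \<open>mat 1 + t *\<^sub>R B\<close>\<close>

lemma square_mem_if_scaling_points:
  fixes L :: "(real^'n^'n) set"
  assumes L: "subspace L" "L \<subseteq> sym_matrices" "mat 1 \<in> L" and B: "B \<in> L"
    and sp: "\<And>Y. Y \<in> pd_matrices \<inter> L \<Longrightarrow> \<exists>W. scaling_point L Y W"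
  shows "B ** B \<in> L"
proof -
  let ?F = "at_right (0 :: real)"
  define Y where "Y t = mat 1 + t *\<^sub>R B" for t :: real
  \<comment> \<open>The choice carries no continuity in \<open>t\<close>; every limit below follows
    from the estimates.\<close>
  define W where "W t = (SOME W. scaling_point L (Y t) W)" for t
  define U where "U t = matrix_inv (W t)" for t
  define V where "V t = matrix_inv (Y t)" for t
  define N where "N t = W t - mat 1" for t
  define E where "E t = U t ** Y t ** U t - mat 1" for t
  define A where "A t = W t ** V t ** W t" for t
  have tpos: "\<forall>\<^sub>F t in ?F. 0 < t" by (rule eventually_at_right_less)
  have t0: "((\<lambda>t. t) \<longlongrightarrow> 0) ?F" by (rule tendsto_ident_at)
  have YL: "Y t \<in> L" for t unfolding Y_def by (intro subspace_add subspace_scale L B)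
  have "isCont matrix_inv (mat 1 :: real^'n^'n)"
    by (rule has_derivative_continuous[OF has_derivative_matrix_inv[OF pd_invertible[OF mat_1_pd]]])
  then have inv_tendsto: "((\<lambda>t. matrix_inv (Z t)) \<longlongrightarrow> mat 1) ?F" if "(Z \<longlongrightarrow> mat 1) ?F" for Z :: "real \<Rightarrow> real^'n^'n"
    using isCont_tendsto_compose that matrix_inv_mat_1 by metis
  have Y_lim: "(Y \<longlongrightarrow> mat 1) ?F"
    unfolding Y_def by (auto intro!: tendsto_eq_intros)
  have V_lim: "(V \<longlongrightarrow> mat 1) ?F" unfolding V_def by (rule inv_tendsto[OF Y_lim])
  have Y_pd: "\<forall>\<^sub>F t in ?F. Y t \<in> pd_matrices"
  proof -
    obtain d where d: "0 < d" "\<And>Z. Z \<in> sym_matrices \<Longrightarrow> norm (Z - mat 1 :: real^'n^'n) < d \<Longrightarrow> Z \<in> pd_matrices"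
      using pd_open_in_sym[OF mat_1_pd] by blast
    show ?thesis
      using tendstoD[OF Y_lim d(1)] by eventually_elim (use YL L(2) d(2) in \<open>auto simp: dist_norm\<close>)
  qed
  have SP: "\<forall>\<^sub>F t in ?F. scaling_point L (Y t) (W t)"
    using Y_pd by eventually_elim (simp add: W_def someI_ex[OF sp] YL)
  have U_lim: "(U \<longlongrightarrow> mat 1) ?F"
  proof -
    let ?b = "\<lambda>t. trace (V t) - trace (mat 1 :: real^'n^'n) + sqrt (trace (V t)) * norm (Y t - mat 1)"
    have tr: "((\<lambda>t. trace (V t)) \<longlongrightarrow> trace (mat 1 :: real^'n^'n)) ?F"
      by (rule bounded_linear.tendsto[OF bounded_linear_trace V_lim])
    have "(?b \<longlongrightarrow> trace (mat 1 :: real^'n^'n) - trace (mat 1 :: real^'n^'n)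
        + sqrt (trace (mat 1 :: real^'n^'n)) * norm (mat 1 - mat 1 :: real^'n^'n)) ?F"
      by (intro tendsto_intros tr Y_lim)
    then have b: "(?b \<longlongrightarrow> 0) ?F" by simp
    have "\<forall>\<^sub>F t in ?F. (norm (U t - mat 1))\<^sup>2 \<le> ?b t"
      using SP Y_pd by eventually_elim (simp add: U_def V_def scaling_point_near_mat_1[OF L(3)])
    then have "((\<lambda>t. (norm (U t - mat 1))\<^sup>2) \<longlongrightarrow> 0) ?F"
      by (intro tendsto_sandwich[OF _ _ tendsto_const b]) auto
    then have "((\<lambda>t. norm (U t - mat 1)) \<longlongrightarrow> 0) ?F"
      by (drule_tac tendsto_real_sqrt) simp
    then show ?thesis
      by (rule LIM_zero_cancel[OF tendsto_norm_zero_cancel])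
  qed
  have W_lim: "(W \<longlongrightarrow> mat 1) ?F"
  proof (rule Lim_transform_eventually[OF inv_tendsto[OF U_lim]])
    have "matrix_inv (matrix_inv Z) = Z" if "Z \<in> pd_matrices" for Z :: "real^'n^'n"
    proof -
      have "matrix_inv (matrix_inv Z) = matrix_inv (matrix_inv Z) ** (matrix_inv Z ** Z)"
        by (simp only: pd_inv_cancel(2)[OF that] matrix_mul_rid)
      also have "\<dots> = Z"
        by (simp only: matrix_mul_assoc pd_inv_cancel(2)[OF matrix_inv_pd[OF that]] matrix_mul_lid)
      finally show ?thesis .
    qed
    then show "\<forall>\<^sub>F t in ?F. matrix_inv (U t) = W t"
      using SP by (auto simp: U_def scaling_point_def elim!: eventually_mono)
  qed
  have N_lim: "(N \<longlongrightarrow> 0) ?F" unfolding N_def using W_lim by (simp add: LIM_zero_iff)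
  have A_lim: "(A \<longlongrightarrow> mat 1) ?F"
    using mm.tendsto[OF mm.tendsto[OF W_lim V_lim] W_lim] by (simp add: A_def[abs_def])
  have nN: "((\<lambda>t. norm (N t)) \<longlongrightarrow> 0) ?F" by (rule tendsto_norm_zero[OF N_lim])
  let ?i = "norm (mat 1 :: real^'n^'n)"
  have nW: "((\<lambda>t. norm (W t)) \<longlongrightarrow> ?i) ?F" and nU: "((\<lambda>t. norm (U t)) \<longlongrightarrow> ?i) ?F"
    by (intro tendsto_norm W_lim U_lim)+
  have small: "\<forall>\<^sub>F t in ?F. f t \<le> c" if "(f \<longlongrightarrow> 0) ?F" "0 < c" for f :: "real \<Rightarrow> real" and c
    using order_tendstoD(2)[OF that] by eventually_elim simp
  have "((\<lambda>t. norm (N t) * norm (W t) + norm (N t)) \<longlongrightarrow> 0 * ?i + 0) ?F"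
    by (intro tendsto_intros nN nW)
  then have c1: "\<forall>\<^sub>F t in ?F. norm (N t) * norm (W t) + norm (N t) \<le> 1 / 2"
    by (intro small) simp_all
  have "((\<lambda>t. norm (A t - mat 1) * norm (U t) + norm (U t - mat 1)) \<longlongrightarrow>
      norm (mat 1 - mat 1 :: real^'n^'n) * ?i + norm (mat 1 - mat 1 :: real^'n^'n)) ?F"
    by (intro tendsto_intros A_lim U_lim nU)
  then have c2: "\<forall>\<^sub>F t in ?F. norm (A t - mat 1) * norm (U t) + norm (U t - mat 1) \<le> 1 / 2"
    by (intro small) simp_all
  have E_le: "\<forall>\<^sub>F t in ?F. norm (E t) \<le> norm (U t) * norm (N t) ^ 3"
    using c1 c2 SP Y_pd
  proof eventually_elim
    case (elim t)
    then show ?case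
      using scaling_point_defect_le[OF L(1,3) elim(4) YL elim(3)]
      unfolding A_def E_def N_def U_def V_def by blast
  qed
  define G where "G t = W t ** E t ** W t" for t
  define k where "k t = norm (W t) * norm (U t) * norm (W t)" for t
  have nk: "(k \<longlongrightarrow> ?i * ?i * ?i) ?F"
    unfolding k_def by (intro tendsto_intros nW nU)
  have G_le: "\<forall>\<^sub>F t in ?F. norm (G t) \<le> k t * norm (N t) ^ 3"
    using E_le
  proof eventually_elim
    case (elim t)
    have "norm (G t) \<le> norm (W t) * norm (E t) * norm (W t)"
      unfolding G_def by (rule norm_matrix_mult3_le)
    also have "\<dots> \<le> norm (W t) * (norm (U t) * norm (N t) ^ 3) * norm (W t)"
      by (intro mult_right_mono mult_left_mono elim norm_ge_zero)
    finally show ?case by (simp add: k_def mult_ac)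
  qed
  \<comment> \<open>\<open>G t = Y t - W t ** W t\<close>, and adding \<open>N t ** N t\<close>
    removes the square of \<open>W t\<close>.\<close>
  have expand: "\<forall>\<^sub>F t in ?F. 2 *\<^sub>R N t = t *\<^sub>R B - (N t ** N t + G t)"
    using SP
  proof eventually_elim
    case (elim t)
    then have "W t \<in> pd_matrices" by (simp add: scaling_point_def)
    note c = pd_inv_cancel[OF this, folded U_def]
    have "W t ** (U t ** Y t ** U t) ** W t = (W t ** U t) ** Y t ** (U t ** W t)"
      by (simp only: matrix_mul_assoc)
    then have "G t = Y t - W t ** W t"
      unfolding G_def E_def by (simp only: mm.diff_left mm.diff_right c matrix_mul_lid matrix_mul_rid)
    moreover have "N t ** N t = W t ** W t - W t - (W t - mat 1)"
      unfolding N_def by (simp only: mm.diff_left mm.diff_right matrix_mul_lid matrix_mul_rid)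
    ultimately show ?case by (simp add: N_def Y_def scaleR_2)
  qed
  \<comment> \<open>In the bound for \<open>2 * norm (N t)\<close> the quadratic and cubic terms are
    eventually at most \<open>norm (N t)\<close>; absorbing them leaves order
    \<open>t\<close>.\<close>
  have N_le: "\<forall>\<^sub>F t in ?F. norm (N t) \<le> t * norm B"
  proof -
    have "((\<lambda>t. norm (N t) + k t * (norm (N t))\<^sup>2) \<longlongrightarrow> 0 + ?i * ?i * ?i * 0\<^sup>2) ?F"
      by (intro tendsto_intros nN nk)
    then have "\<forall>\<^sub>F t in ?F. norm (N t) + k t * (norm (N t))\<^sup>2 \<le> 1"
      by (intro small) simp_all
    then show ?thesis
      using expand G_le tpos
    proof eventually_elim
      case (elim t)
      have "2 * norm (N t) = norm (t *\<^sub>R B - (N t ** N t + G t))"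
        by (simp flip: elim(2))
      also have "\<dots> \<le> norm (t *\<^sub>R B) + (norm (N t ** N t) + norm (G t))"
        by (intro order_trans[OF norm_triangle_ineq4] add_left_mono norm_triangle_ineq)
      also have "\<dots> \<le> t * norm B + (norm (N t) * norm (N t) + k t * norm (N t) ^ 3)"
        using elim(3,4) norm_matrix_mult_le[of "N t" "N t"] by simp
      also have "\<dots> = t * norm B + (norm (N t) + k t * (norm (N t))\<^sup>2) * norm (N t)"
        by (simp add: power2_eq_square power3_eq_cube algebra_simps)
      also have "\<dots> \<le> t * norm B + 1 * norm (N t)"
        by (intro add_left_mono mult_right_mono elim norm_ge_zero)
      finally show ?case by simp
    qed
  qed
  have k_nonneg: "0 \<le> k t" for t by (simp add: k_def)
  \<comment> \<open>Two of the three factors \<open>norm (N t)\<close> are paid for by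
    \<open>t^2\<close>; the third still tends to 0. A merely quadratic bound on \<open>G t\<close>
    would not give this.\<close>
  have G2: "((\<lambda>t. (1 / t\<^sup>2) *\<^sub>R G t) \<longlongrightarrow> 0) ?F"
  proof (rule Lim_null_comparison)
    show "\<forall>\<^sub>F t in ?F. norm ((1 / t\<^sup>2) *\<^sub>R G t) \<le> k t * norm (N t) * (norm B)\<^sup>2"
      using G_le N_le tpos
    proof eventually_elim
      case (elim t)
      have "norm (G t) \<le> k t * norm (N t) * (norm (N t))\<^sup>2"
        using elim(1) by (simp add: power2_eq_square power3_eq_cube mult_ac)
      also have "\<dots> \<le> k t * norm (N t) * (t * norm B)\<^sup>2"
        using elim(2) k_nonneg by (intro mult_left_mono power_mono) auto
      finally show ?case
        using elim(3) by (simp add: field_simps power_mult_distrib)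
    qed
    have "((\<lambda>t. k t * norm (N t) * (norm B)\<^sup>2) \<longlongrightarrow> ?i * ?i * ?i * 0 * (norm B)\<^sup>2) ?F"
      by (intro tendsto_intros nN nk)
    then show "((\<lambda>t. k t * norm (N t) * (norm B)\<^sup>2) \<longlongrightarrow> 0) ?F" by simp
  qed
  have G1: "((\<lambda>t. (1 / t) *\<^sub>R G t) \<longlongrightarrow> 0) ?F"
  proof (rule Lim_transform_eventually)
    show "((\<lambda>t. t *\<^sub>R ((1 / t\<^sup>2) *\<^sub>R G t)) \<longlongrightarrow> 0) ?F"
      using tendsto_scaleR[OF t0 G2] by simp
    show "\<forall>\<^sub>F t in ?F. t *\<^sub>R ((1 / t\<^sup>2) *\<^sub>R G t) = (1 / t) *\<^sub>R G t"
      using tpos by eventually_elim (simp add: power2_eq_square)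
  qed
  have NN1: "((\<lambda>t. (1 / t) *\<^sub>R (N t ** N t)) \<longlongrightarrow> 0) ?F"
  proof (rule Lim_null_comparison)
    show "\<forall>\<^sub>F t in ?F. norm ((1 / t) *\<^sub>R (N t ** N t)) \<le> norm B * norm (N t)"
      using N_le tpos
    proof eventually_elim
      case (elim t)
      have "norm (N t ** N t) \<le> norm (N t) * norm (N t)" by (rule norm_matrix_mult_le)
      also have "\<dots> \<le> t * norm B * norm (N t)" by (intro mult_right_mono elim norm_ge_zero)
      finally show ?case using elim(2) by (simp add: field_simps)
    qed
    show "((\<lambda>t. norm B * norm (N t)) \<longlongrightarrow> 0) ?F"
      by (rule tendsto_mult_right_zero[OF nN])
  qed
  have N1: "((\<lambda>t. (1 / t) *\<^sub>R N t) \<longlongrightarrow> (1 / 2) *\<^sub>R B) ?F"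
  proof (rule Lim_transform_eventually)
    have "((\<lambda>t. (1 / 2) *\<^sub>R (B - ((1 / t) *\<^sub>R (N t ** N t) + (1 / t) *\<^sub>R G t))) \<longlongrightarrow> (1 / 2) *\<^sub>R (B - (0 + 0))) ?F"
      by (intro tendsto_intros NN1 G1)
    then show "((\<lambda>t. (1 / 2) *\<^sub>R (B - ((1 / t) *\<^sub>R (N t ** N t) + (1 / t) *\<^sub>R G t))) \<longlongrightarrow> (1 / 2) *\<^sub>R B) ?F"
      by simp
    show "\<forall>\<^sub>F t in ?F. (1 / 2) *\<^sub>R (B - ((1 / t) *\<^sub>R (N t ** N t) + (1 / t) *\<^sub>R G t)) = (1 / t) *\<^sub>R N t"
      using expand tpos
    proof eventually_elim
      case (elim t)
      have "N t = (1 / 2) *\<^sub>R (2 *\<^sub>R N t)" by simp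
      then have "(1 / t) *\<^sub>R N t = (1 / t) *\<^sub>R (1 / 2) *\<^sub>R (t *\<^sub>R B - (N t ** N t + G t))"
        unfolding elim(1) by (rule arg_cong)
      then show ?case using elim(2) by (simp add: scaleR_diff_right scaleR_add_right mult.commute)
    qed
  qed
  let ?Q = "\<lambda>t. (1 / t\<^sup>2) *\<^sub>R (N t ** N t + G t)"
  have "((\<lambda>t. ((1 / t) *\<^sub>R N t) ** ((1 / t) *\<^sub>R N t) + (1 / t\<^sup>2) *\<^sub>R G t) \<longlongrightarrow>
      ((1 / 2) *\<^sub>R B) ** ((1 / 2) *\<^sub>R B) + 0) ?F"
    by (intro tendsto_add mm.tendsto N1 G2)
  then have "(?Q \<longlongrightarrow> (1 / 4) *\<^sub>R (B ** B)) ?F"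
    by (simp add: mm.scaleR_left mm.scaleR_right power2_eq_square scaleR_add_right)
  \<comment> \<open>By \<open>expand\<close> the numerator is
    \<open>t *\<^sub>R B - 2 *\<^sub>R N t\<close>, a combination of elements of
    \<open>L\<close>.\<close>
  moreover have "\<forall>\<^sub>F t in ?F. ?Q t \<in> L"
    using expand SP
  proof eventually_elim
    case (elim t)
    then have "N t \<in> L" unfolding N_def scaling_point_def by (intro subspace_diff L) blast
    then have "t *\<^sub>R B - 2 *\<^sub>R N t \<in> L" by (intro subspace_diff subspace_scale L B)
    then show "?Q t \<in> L" unfolding elim(1) by (intro subspace_scale L) simp
  qed
  ultimately have "(1 / 4) *\<^sub>R (B ** B) \<in> L"
    by (rule Lim_in_closed_set[OF closed_subspace[OF L(1)] _ trivial_limit_at_right_real, rotated])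
  then have "4 *\<^sub>R (1 / 4) *\<^sub>R (B ** B) \<in> L" by (rule subspace_scale[OF L(1)])
  then show ?thesis by simp
qed

section \<open>From the barrier equations to scaling points\<close>

theorem proposition6p2:
  fixes L :: "(real^'n^'n) set"
  assumes "subspace L"
    and "L \<subseteq> sym_matrices"
    and "mat 1 \<in> L"
    and "\<not> (\<forall>A\<in>L. A ** A \<in> L)"
  defines "K \<equiv> psd_section L"
    and "F \<equiv> log_det_barrier"
  shows "\<exists>X \<in> interior_in L K. \<exists>S \<in> interior_in L (dual_cone_in L K).
           \<forall>W \<in> interior_in L K.
             hess_in L F W X \<noteq> S \<or>
             hess_in L F W (- grad_in L (conjugate_barrier L) S) \<noteq> - grad_in L F X"
proof (rule ccontr)
  assume contra: "\<not> ?thesis"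
  note L = assms(1-3)
  obtain P where P: "bounded_linear P" "\<And>x. P x \<in> L" "\<And>x h. h \<in> L \<Longrightarrow> P x \<bullet> h = x \<bullet> h"
    using orthogonal_projection_exists[OF L(1)] by metis
  have int_K: "interior_in L K = pd_matrices \<inter> L"
    unfolding K_def by (rule interior_psd_section[OF L])
  have "\<exists>W. scaling_point L Y W" if Y: "Y \<in> pd_matrices \<inter> L" for Y
  proof -
    \<comment> \<open>This dual point has \<open>- Y\<close> as conjugate gradient; the primal point
      paired with it is always \<open>mat 1\<close>, whose negated barrier gradient is
      \<open>mat 1\<close>.\<close>
    define S where "S = P (matrix_inv Y)"
    have SL: "S \<in> L" and S: "\<And>H. H \<in> L \<Longrightarrow> S \<bullet> H = matrix_inv Y \<bullet> H"
      by (auto simp: S_def P)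
    have Yi: "matrix_inv Y \<in> pd_matrices" using Y by (simp add: matrix_inv_pd)
    have "S \<in> interior_in L (dual_cone_in L K)"
      unfolding K_def by (rule projected_inverse_in_interior_dual[OF L(1,2) Yi SL S])
    moreover have "mat 1 \<in> interior_in L K" unfolding int_K using mat_1_pd L(3) by blast
    ultimately obtain W where W: "W \<in> pd_matrices \<inter> L" "hess_in L F W (mat 1) = S"
        "hess_in L F W (- grad_in L (conjugate_barrier L) S) = - grad_in L F (mat 1)"
      using contra int_K by blast
    let ?U = "matrix_inv W"
    have U: "?U \<in> sym_matrices" using W by (simp add: pd_imp_sym matrix_inv_pd)
    have "grad_in L (conjugate_barrier L) S = - Y"
      using Y by (intro grad_conjugate_barrier[OF L _ _ SL S]) auto
    moreover have "grad_in L F (mat 1) = - mat 1"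
      unfolding F_def by (rule grad_log_det_barrier[OF L(1,2) mat_1_pd L(3) L(3)]) (simp add: matrix_inv_mat_1)
    ultimately have "hess_in L F W Y = mat 1" using W(3) by simp
    moreover have hess: "hess_in L F W H = P (?U ** H ** ?U)" if "H \<in> L" for H
      unfolding F_def using W that by (intro hess_log_det_barrier[OF L(1,2) _ _ _ P]) auto
    ultimately have eqs: "P (?U ** ?U) = S" "P (?U ** Y ** ?U) = mat 1"
      using W(2) hess[OF L(3)] hess[of Y] Y by simp_all
    have UU: "?U ** ?U \<in> sym_matrices" "?U ** Y ** ?U \<in> sym_matrices"
      using sym_matrices_congruence[OF pd_imp_sym[OF mat_1_pd] U] sym_matrices_congruence[OF _ U, of Y] Y
      by (simp_all add: pd_imp_sym)
    \<comment> \<open>Pairing the projected equations with \<open>H\<close> in \<open>L\<close>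
      removes \<open>P\<close>; symmetry of the matrices turns inner products into traces.\<close>
    have "trace (?U ** ?U ** H) = trace (matrix_inv Y ** H) \<and> trace (?U ** Y ** ?U ** H) = trace H"
      if "H \<in> L" for H
      using P(3)[OF that, of "?U ** ?U"] P(3)[OF that, of "?U ** Y ** ?U"] S[OF that]
      unfolding eqs trace_mult_eq_inner[OF UU(1)] trace_mult_eq_inner[OF UU(2)]
        trace_mult_eq_inner[OF pd_imp_sym[OF Yi]]
        trace_eq_inner_mat_1[of H]
      by simp
    with W(1) show ?thesis unfolding scaling_point_def by blast
  qed
  then have "\<forall>A\<in>L. A ** A \<in> L" using square_mem_if_scaling_points[OF L] by blast
  with assms(4) show False by blast
qed

end
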